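(* Let $d \geqslant 2$, let $P_0$ be a $2$-level $(d-1)$-dimensional polytope and let $\Gamma_0$ be a simplicial core of $P_0$, with $P_0$ embedded in $\{0\}\times\mathbb{R}^{d-1}$ by its $\mathcal{H}$-embedding with respect to $\Gamma_0$. Let $\mathcal{X}_{\mathrm{full}}$, $\mathcal{X} \subseteq \mathcal{X}_{\mathrm{full}}$ and the closure operator $\mathrm{cl} = \mathrm{cl}_{\mathrm{inc}} \circ \mathrm{cl}_{\mathrm{dch}}$ on $2^{\mathcal{X}_{\mathrm{full}}}$ be as defined in the context. Then the collection $\mathcal{A}$ of all sets $A \subseteq \mathcal{X}$ with $\mathrm{cl}(A) = A$ is a complete family with respect to $P_0$, $\Gamma_0$; that is, $e_1 \in A$ for every $A \in \mathcal{A}$, and every $2$-level $d$-polytope having a facet isomorphic to $P_0$ has an $\mathcal{H}$-embedding (with respect to some simplicial core) of the form $\mathrm{conv}(\mathrm{vert}(P_0) \cup A)$ for some $A \in \mathcal{A}$.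
   Context: A polytope $P$ is $2$-level if every hyperplane $H$ that is facet-defining for $P$ has a parallel hyperplane $H'$ containing all vertices of $P$ not in $H$ (the empty set and points are $2$-level). A $d$-polytope is a polytope of dimension $d$; $\mathrm{vert}(P)$ is its vertex set. Isomorphic means combinatorially equivalent, which for $2$-level polytopes coincides with affinely equivalent. For $x\in\mathbb{R}^d$ and $E\subseteq[d]=\{1,\dots,d\}$, $x(E):=\sum_{i\in E}x_i$; $e_i$ is the $i$-th unit vector of $\mathbb{R}^d$. A simplicial core of a $d$-polytope $P$ is a tuple $(F_1,\dots,F_{d+1};v_1,\dots,v_{d+1})$ of facets $F_i$ and vertices $v_i$ of $P$ such that $F_i$ does not contain $v_i$ but contains $v_{i+1},\dots,v_{d+1}$ (then $v_1,\dots,v_{d+1}$ are affinely independent). The $\mathcal{H}$-embedding of a $2$-level $d$-polytope $P$ with respect to it is the image of $P$ under the affine map sending $v_j\mapsto e_j$ for $1\leqslant j\leqslant d$ and $v_{d+1}\mapsto 0$. Setting. $P_0$ is a $2$-level $(d-1)$-polytope with simplicial core $\Gamma_0=(F'_2,\dots,F'_{d+1};v_2,\dots,v_{d+1})$ (indexed from $2$ to $d+1$), identified with its $\mathcal{H}$-embedding in $\{0\}\times\mathbb{R}^{d-1}\subseteq\mathbb{R}^d$, i.e. $v_j=e_j$ for $2\leqslant j\leqslant d$ and $v_{d+1}=0$. $M_{d-1}$ is the $(d-1)\times(d-1)$ $0/1$-matrix with rows indexed by $F'_2,\dots,F'_d$ and columns by $v_2,\dots,v_d$, with entry $0$ if the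 vertex lies on the facet and $1$ otherwise. For $c\in\{0,1\}^{d-1}$, $M_d(c)=\begin{pmatrix}1&0\\ c&M_{d-1}\end{pmatrix}$. The ground set is $$\mathcal{X}_{\mathrm{full}}:=\bigcup_{c\in\{0,1\}^{d-1}}M_d(c)^{-1}\cdot(\{1\}\times\{0,1\}^{d-1}).$$ Discrete convex hull operator. For $B\subseteq\mathrm{vert}(P_0)\cup\mathcal{X}_{\mathrm{full}}$ let $\mathcal{E}(B):=\{E\subseteq[d]\mid E\neq\varnothing,\ 0\leqslant x(E)\leqslant1\text{ for every }x\in B\}$. For $A\subseteq\mathcal{X}_{\mathrm{full}}$, $\mathrm{cl}_{\mathrm{dch}}(A):=\{x\in\mathcal{X}_{\mathrm{full}}\mid 0\leqslant x(E)\leqslant1\text{ for every }E\in\mathcal{E}(\mathrm{vert}(P_0)\cup A)\}$. Incompatibility operator. Three points $u,v,w\in\mathrm{vert}(P_0)\cup\mathcal{X}_{\mathrm{full}}$ are incompatible if there is a facet $F_0$ of $P_0$ such that $\mathrm{aff}(F_0)$ and its three translates containing $u$, $v$, $w$ respectively cannot be covered by any two parallel hyperplanes other than $\{0\}\times\mathbb{R}^{d-1}$ and $\{1\}\times\mathbb{R}^{d-1}$. For $A\subseteq\mathcal{X}_{\mathrm{full}}$, $\mathrm{cl}_{\mathrm{inc}}(A):=A$ if $\mathrm{vert}(P_0)\cup A$ contains no incompatible triple, and $\mathrm{cl}_{\mathrm{inc}}(A):=\mathcal{X}_{\mathrm{full}}$ otherwise. Reduced ground set. Let $\mathcal{F}$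 be the collection of nonempty $E\subseteq\{2,\dots,d\}$ such that $x(E)\geqslant0$ or $x(E)\leqslant1$ defines a facet of $P_0$, and $\mathcal{X}_{\mathrm{inc}}:=\{u\in\mathcal{X}_{\mathrm{full}}\mid u(E)\in\{-1,0,1\}\text{ for every }E\in\mathcal{F}\}$. Let $\preccurlyeq$ be the lexicographic order on $\mathbb{R}^d$ and define the linear order $\preccurlyeq_M$ by $a\preccurlyeq_M b\iff M_d(0)a\preccurlyeq M_d(0)b$. Then $\mathcal{X}:=\{x\in\mathcal{X}_{\mathrm{inc}}\mid e_1\preccurlyeq_M x\}$. *)

theory Defs
  imports "HOL-Analysis.Analysis"
begin

text \<open>
  The space \<open>\<real>\<^sup>d\<close> is \<open>real ^ 'n\<close> with \<open>d = CARD('n)\<close>; the order of \<open>'n\<close> numbers the coordinates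
  by \<open>1, \<dots>, d\<close>.  The numeral types are of sort \<open>{finite, wellorder}\<close>, so all \<open>d \<ge> 1\<close> occur.
\<close>

definition pos :: "'n::{finite,wellorder} \<Rightarrow> nat" where
  "pos p = card {..p}"

definition idx :: "nat \<Rightarrow> 'n::{finite,wellorder}" where
  "idx = inv pos"

definition evec :: "nat \<Rightarrow> real ^ 'n::{finite,wellorder}" where
  "evec i = axis (idx i) 1"

definition coordsum :: "real ^ 'n::{finite,wellorder} \<Rightarrow> nat set \<Rightarrow> real" where
  "coordsum x E = (\<Sum>i\<in>E. x $ idx i)"

definition lex_le :: "real ^ 'n::{finite,wellorder} \<Rightarrow> real ^ 'n::{finite,wellorder} \<Rightarrow> bool" where
  "lex_le x y \<longleftrightarrow> x = y \<or> (\<exists>p. x $ p < y $ p \<and> (\<forall>q<p. x $ q = y $ q))"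

lemma bij_betw_pos: "bij_betw pos (UNIV :: 'n::{finite,wellorder} set) {1..CARD('n)}"
proof -
  have inj: "inj (pos :: 'n \<Rightarrow> nat)"
  proof (rule linorder_injI)
    fix p q :: 'n
    assume "p < q"
    then have "{..p} \<subset> {..q}" by auto
    then have "pos p < pos q" unfolding pos_def by (intro psubset_card_mono) auto
    then show "pos p \<noteq> pos q" by simp
  qed
  have "pos p \<in> {1..CARD('n)}" for p :: 'n
    unfolding pos_def by (auto simp: card_gt_0_iff Suc_le_eq intro: card_mono)
  then have sub: "range (pos :: 'n \<Rightarrow> nat) \<subseteq> {1..CARD('n)}" by auto
  have "card (range (pos :: 'n \<Rightarrow> nat)) = CARD('n)"
    by (rule card_image) (rule inj)
  then have "range (pos :: 'n \<Rightarrow> nat) = {1..CARD('n)}"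
    by (intro card_subset_eq) (use sub in auto)
  with inj show ?thesis by (simp add: bij_betw_def)
qed

lemma pos_idx: "k \<in> {1..CARD('n)} \<Longrightarrow> pos (idx k :: 'n::{finite,wellorder}) = k"
  using bij_betw_pos[where 'n='n] unfolding idx_def bij_betw_def by (metis f_inv_into_f)

lemma idx_pos: "idx (pos p) = (p :: 'n::{finite,wellorder})"
  using bij_betw_pos[where 'n='n] unfolding idx_def bij_betw_def by (simp add: inv_f_f)

definition vert :: "'a::euclidean_space set \<Rightarrow> 'a set" where
  "vert P = {x. x extreme_point_of P}"

definition facet_defining :: "'a::euclidean_space set \<Rightarrow> 'a set \<Rightarrow> bool" where
  "facet_defining H P \<longleftrightarrow>
     (\<exists>a b. a \<noteq> 0 \<and> H = {x. a \<bullet> x = b} \<and> P \<subseteq> {x. a \<bullet> x \<le> b} \<and> (P \<inter> H) facet_of P)"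

text \<open>
  The empty set and points have no facets in the sense of \<open>facet_of\<close> (facets are nonempty there),
  so they are 2-level.
\<close>

definition two_level :: "'a::euclidean_space set \<Rightarrow> bool" where
  "two_level P \<longleftrightarrow> polytope P \<and>
     (\<forall>H. facet_defining H P \<longrightarrow> (\<exists>H'. affine_parallel H H' \<and> vert P - H \<subseteq> H'))"

definition comb_equivalent :: "'a::euclidean_space set \<Rightarrow> 'b::euclidean_space set \<Rightarrow> bool" where
  "comb_equivalent P Q \<longleftrightarrow>
     (\<exists>\<phi>. bij_betw \<phi> {F. F face_of P} {G. G face_of Q} \<and>
        (\<forall>F F'. F face_of P \<longrightarrow> F' face_of P \<longrightarrow> (F \<subseteq> F' \<longleftrightarrow> \<phi> F \<subseteq> \<phi> F')))"

text \<open>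
  \<open>simplicial_core l u P F v\<close>: \<open>(F\<^sub>l, \<dots>, F\<^sub>u; v\<^sub>l, \<dots>, v\<^sub>u)\<close> is a simplicial core of \<open>P\<close>.  Its length is
  the dimension of \<open>P\<close> plus one; \<open>F\<close> and \<open>v\<close> are irrelevant outside of \<open>{l..u}\<close>.
\<close>

definition simplicial_core ::
  "nat \<Rightarrow> nat \<Rightarrow> 'a::euclidean_space set \<Rightarrow> (nat \<Rightarrow> 'a set) \<Rightarrow> (nat \<Rightarrow> 'a) \<Rightarrow> bool" where
  "simplicial_core l u P F v \<longleftrightarrow> aff_dim P = int u - int l \<and>
     (\<forall>i\<in>{l..u}. F i facet_of P \<and> v i \<in> vert P \<and> v i \<notin> F i \<and> (\<forall>j\<in>{i<..u}. v j \<in> F i))"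

text \<open>
  \<open>R\<close> is the \<open>\<H>\<close>-embedding of \<open>P\<close> with respect to a simplicial core with vertices
  \<open>v\<^sub>1, \<dots>, v\<^sub>d\<^sub>+\<^sub>1\<close>.  The polytope \<open>P\<close> may live in any Euclidean space; the affine map is unique on the
  affine hull of \<open>P\<close>.
\<close>

definition H_embedding ::
  "'a::euclidean_space set \<Rightarrow> (nat \<Rightarrow> 'a) \<Rightarrow> (real ^ 'n::{finite,wellorder}) set \<Rightarrow> bool" where
  "H_embedding P v R \<longleftrightarrow>
     (\<exists>f. (\<exists>g b. linear g \<and> f = (\<lambda>x. g x + b)) \<and>
          (\<forall>j\<in>{1..CARD('n)}. f (v j) = evec j) \<and> f (v (CARD('n) + 1)) = 0 \<and>
          R = f ` P)"

text \<open>
  The matrix \<open>M\<^sub>d(c)\<close>, for a core \<open>(F\<^sub>2, \<dots>, F\<^sub>d\<^sub>+\<^sub>1; v\<^sub>2, \<dots>, v\<^sub>d\<^sub>+\<^sub>1)\<close>; only \<open>c 2, \<dots>, c d\<close> are used.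
\<close>

definition core_matrix ::
  "(nat \<Rightarrow> (real ^ 'n::{finite,wellorder}) set) \<Rightarrow> (nat \<Rightarrow> real ^ 'n::{finite,wellorder}) \<Rightarrow> (nat \<Rightarrow> real)
    \<Rightarrow> real ^ 'n::{finite,wellorder} ^ 'n::{finite,wellorder}" where
  "core_matrix F v c =
     (\<chi> p q. let i = pos p; j = pos q in
        if i = 1 then (if j = 1 then 1 else 0)
        else if j = 1 then c i
        else if v j \<in> F i then 0 else 1)"

lemma core_matrix_invertible:
  fixes P0 :: "(real ^ 'n::{finite,wellorder}) set"
  assumes core: "simplicial_core 2 (CARD('n) + 1) P0 F v"
  shows "invertible (core_matrix F v c)"
proof -
  have range: "pos p \<in> {1..CARD('n)}" for p :: 'n
    using bij_betw_pos[where 'n='n] by (auto simp: bij_betw_def)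
  have mono: "pos p < pos q" if "p < q" for p q :: 'n
    unfolding pos_def using that by (intro psubset_card_mono) auto
  have low: "core_matrix F v c $ p $ q = 0" if "p < q" for p q :: 'n
    using mono[OF that] range[of p] range[of q] core
    by (auto simp: core_matrix_def simplicial_core_def Let_def)
  have diag: "core_matrix F v c $ p $ p = 1" for p :: 'n
    using range[of p] core
    by (auto simp: core_matrix_def simplicial_core_def Let_def)
  have "det (core_matrix F v c) = 1"
    by (subst det_lowerdiagonal) (auto simp: low diag)
  then show ?thesis by (simp add: invertible_det_nz)
qed

definition X_full ::
  "(nat \<Rightarrow> (real ^ 'n::{finite,wellorder}) set) \<Rightarrow> (nat \<Rightarrow> real ^ 'n::{finite,wellorder}) \<Rightarrow> (real ^ 'n::{finite,wellorder}) set" where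
  "X_full F v =
     (\<Union>c\<in>{c. \<forall>i\<in>{2..CARD('n)}. c i \<in> {0, 1}}.
        (\<lambda>y. matrix_inv (core_matrix F v c) *v y) `
          {y. y $ idx 1 = 1 \<and> (\<forall>i\<in>{2..CARD('n)}. y $ idx i \<in> {0, 1})})"

definition slab_sets :: "(real ^ 'n::{finite,wellorder}) set \<Rightarrow> nat set set" where
  "slab_sets B = {E. E \<subseteq> {1..CARD('n)} \<and> E \<noteq> {} \<and> (\<forall>x\<in>B. 0 \<le> coordsum x E \<and> coordsum x E \<le> 1)}"

definition cl_dch ::
  "(real ^ 'n::{finite,wellorder}) set \<Rightarrow> (nat \<Rightarrow> (real ^ 'n::{finite,wellorder}) set) \<Rightarrow> (nat \<Rightarrow> real ^ 'n::{finite,wellorder})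
    \<Rightarrow> (real ^ 'n::{finite,wellorder}) set \<Rightarrow> (real ^ 'n::{finite,wellorder}) set" where
  "cl_dch P0 F v A =
     {x \<in> X_full F v. \<forall>E\<in>slab_sets (vert P0 \<union> A). 0 \<le> coordsum x E \<and> coordsum x E \<le> 1}"

text \<open>
  The excluded pair of parallel hyperplanes is the pair consisting of \<open>{0} \<times> \<real>\<^sup>d\<^sup>-\<^sup>1\<close> and
  \<open>{1} \<times> \<real>\<^sup>d\<^sup>-\<^sup>1\<close>.
\<close>

definition incompatible ::
  "(real ^ 'n::{finite,wellorder}) set \<Rightarrow> (nat \<Rightarrow> (real ^ 'n::{finite,wellorder}) set) \<Rightarrow> (nat \<Rightarrow> real ^ 'n::{finite,wellorder})
    \<Rightarrow> real ^ 'n::{finite,wellorder} \<Rightarrow> real ^ 'n::{finite,wellorder} \<Rightarrow> real ^ 'n::{finite,wellorder} \<Rightarrow> bool" where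
  "incompatible P0 F v x y z \<longleftrightarrow>
     {x, y, z} \<subseteq> vert P0 \<union> X_full F v \<and>
     (\<exists>F0. F0 facet_of P0 \<and>
        \<not> (\<exists>H1 H2. (\<exists>a b. a \<noteq> 0 \<and> H1 = {t. a \<bullet> t = b}) \<and> affine_parallel H1 H2 \<and>
              {H1, H2} \<noteq> {{t. t $ idx 1 = 0}, {t. t $ idx 1 = 1}} \<and>
              affine hull F0 \<subseteq> H1 \<union> H2 \<and>
              (\<forall>T. affine_parallel (affine hull F0) T \<and> T \<inter> {x, y, z} \<noteq> {} \<longrightarrow> T \<subseteq> H1 \<union> H2)))"

definition cl_inc ::
  "(real ^ 'n::{finite,wellorder}) set \<Rightarrow> (nat \<Rightarrow> (real ^ 'n::{finite,wellorder}) set) \<Rightarrow> (nat \<Rightarrow> real ^ 'n::{finite,wellorder})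
    \<Rightarrow> (real ^ 'n::{finite,wellorder}) set \<Rightarrow> (real ^ 'n::{finite,wellorder}) set" where
  "cl_inc P0 F v A =
     (if \<exists>x\<in>vert P0 \<union> A. \<exists>y\<in>vert P0 \<union> A. \<exists>z\<in>vert P0 \<union> A. incompatible P0 F v x y z
      then X_full F v else A)"

definition facet_sets :: "(real ^ 'n::{finite,wellorder}) set \<Rightarrow> nat set set" where
  "facet_sets P0 =
     {E. E \<subseteq> {2..CARD('n)} \<and> E \<noteq> {} \<and>
        ((\<forall>x\<in>P0. coordsum x E \<ge> 0) \<and> (P0 \<inter> {x. coordsum x E = 0}) facet_of P0 \<or>
         (\<forall>x\<in>P0. coordsum x E \<le> 1) \<and> (P0 \<inter> {x. coordsum x E = 1}) facet_of P0)}"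

definition X_inc ::
  "(real ^ 'n::{finite,wellorder}) set \<Rightarrow> (nat \<Rightarrow> (real ^ 'n::{finite,wellorder}) set) \<Rightarrow> (nat \<Rightarrow> real ^ 'n::{finite,wellorder})
    \<Rightarrow> (real ^ 'n::{finite,wellorder}) set" where
  "X_inc P0 F v = {x \<in> X_full F v. \<forall>E\<in>facet_sets P0. coordsum x E \<in> {-1, 0, 1}}"

definition core_le ::
  "(nat \<Rightarrow> (real ^ 'n::{finite,wellorder}) set) \<Rightarrow> (nat \<Rightarrow> real ^ 'n::{finite,wellorder})
    \<Rightarrow> real ^ 'n::{finite,wellorder} \<Rightarrow> real ^ 'n::{finite,wellorder} \<Rightarrow> bool" where
  "core_le F v x y \<longleftrightarrow> lex_le (core_matrix F v (\<lambda>_. 0) *v x) (core_matrix F v (\<lambda>_. 0) *v y)"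

definition X_red ::
  "(real ^ 'n::{finite,wellorder}) set \<Rightarrow> (nat \<Rightarrow> (real ^ 'n::{finite,wellorder}) set) \<Rightarrow> (nat \<Rightarrow> real ^ 'n::{finite,wellorder})
    \<Rightarrow> (real ^ 'n::{finite,wellorder}) set" where
  "X_red P0 F v = {x \<in> X_inc P0 F v. core_le F v (evec 1) x}"

text \<open>
  The type argument is the Euclidean space in which the \<open>d\<close>-polytopes \<open>Q\<close> live.  The core \<open>\<Gamma>\<^sub>0\<close> enters
  only through the embedding of \<open>P\<^sub>0\<close>.
\<close>

definition complete_family ::
  "'b::euclidean_space itself \<Rightarrow> (real ^ 'n::{finite,wellorder}) set \<Rightarrow> (real ^ 'n::{finite,wellorder}) set set \<Rightarrow> bool"
  where
  "complete_family TYPE('b) P0 \<A> \<longleftrightarrow>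
     (\<forall>A\<in>\<A>. evec 1 \<in> A) \<and>
     (\<forall>Q :: 'b set. two_level Q \<and> aff_dim Q = int CARD('n) \<and>
          (\<exists>G. G facet_of Q \<and> comb_equivalent G P0) \<longrightarrow>
        (\<exists>A\<in>\<A>. \<exists>F v. simplicial_core 1 (CARD('n) + 1) Q F v \<and>
            H_embedding Q v (convex hull (vert P0 \<union> A))))"

end

theory Submission
  imports Defs
begin

text \<open>
  That \<open>e\<^sub>1\<close> lies in every closed set is immediate: \<open>e\<^sub>1\<close> belongs to the full ground set, its
  coordinate sums are all \<open>0\<close> or \<open>1\<close>, so it lies in every discrete convex hull, and the
  incompatibility operator can only enlarge a subset of the ground set.

  For completeness, let \<open>Q\<close> be a 2-level \<open>d\<close>-polytope with a facet \<open>G\<close> combinatorially equivalent to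
  \<open>P\<^sub>0\<close>.  The guiding principle is that in a 2-level polytope every facet is the zero set of an affine
  functional that takes only the values \<open>0\<close> and \<open>1\<close> on vertices (\<open>two_level_unit_slack\<close>), so the
  values of these functionals are mere incidence data and are preserved by combinatorial
  equivalence.  An isomorphism of face lattices matches vertices of \<open>P\<^sub>0\<close> with vertices of \<open>G\<close>, and
  every facet of \<open>P\<^sub>0\<close> with the trace on \<open>G\<close> of some facet of \<open>Q\<close> (\<open>vertex_correspondence\<close>).

  Let \<open>T = (t\<^sub>1, \<dots>, t\<^sub>d)\<close> collect the 0/1-functionals of \<open>G\<close> and of the facets of \<open>Q\<close> that extend
  \<open>F'\<^sub>2, \<dots>, F'\<^sub>d\<close>.  Take as \<open>v\<^sub>1\<close> a vertex off \<open>G\<close> for which \<open>T v\<^sub>1\<close> is lexicographically least, let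
  \<open>c\<close> be the tail of \<open>T v\<^sub>1\<close>, and put \<open>f = M\<^sub>d(c)\<^sup>-\<^sup>1 \<circ> T\<close>.  Comparing 0/1-values shows that \<open>f\<close> sends
  each vertex of \<open>G\<close> to its partner in \<open>P\<^sub>0\<close>, and \<open>v\<^sub>1\<close> to \<open>e\<^sub>1\<close>.  Hence \<open>f Q\<close> is an
  \<open>\<H>\<close>-embedding of \<open>Q\<close>, and it equals \<open>conv(vert P\<^sub>0 \<union> A)\<close> for \<open>A\<close> the image of the vertices off \<open>G\<close>
  (\<open>ex_facet_extension\<close>).  In particular \<open>f\<close> realises the combinatorial equivalence of \<open>G\<close> and \<open>P\<^sub>0\<close>
  by an affine map.

  It remains to see that \<open>A\<close> is a closed subset of the reduced ground set; the locale
  \<open>facet_extension\<close> isolates what this takes.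
  \<^item> The rows of \<open>M\<^sub>d(c)\<close> are the functionals \<open>t\<^sub>i\<close> read in the embedding, so \<open>M\<^sub>d(c)\<close> maps \<open>A\<close> into
    \<open>{1} \<times> {0,1}\<^sup>d\<^sup>-\<^sup>1\<close>, that is, \<open>A\<close> lies in the full ground set.
  \<^item> If \<open>x(E)\<close> describes a facet of \<open>P\<^sub>0\<close>, a 0/1-functional extending it differs from \<open>x(E)\<close> or
    \<open>1 - x(E)\<close> by a multiple of \<open>x\<^sub>1\<close>, which is determined by its 0/1-value at \<open>e\<^sub>1\<close>; this gives
    \<open>u(E) \<in> {-1,0,1}\<close> on \<open>A\<close>.
  \<^item> A functional with 0/1-values at \<open>0, e\<^sub>1, \<dots>, e\<^sub>d\<close> is \<open>x(E)\<close> or \<open>1 - x(E)\<close>, so the slab inequalities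
    cut out the polytope.  A point of the full ground set is integral, and an integral point of the
    polytope is mapped by the unimodular \<open>M\<^sub>d(c)\<close> to a vertex of the cube, hence is a vertex.  So \<open>A\<close>
    is fixed by the discrete convex hull operator.
  \<^item> The two level sets \<open>0\<close> and \<open>1\<close> of a 0/1-functional extending a facet of \<open>P\<^sub>0\<close> cover all the
    translates in question, so there is no incompatible triple.
  \<^item> Minimality of \<open>T v\<^sub>1\<close> is precisely \<open>e\<^sub>1 \<preceq>\<^sub>M x\<close> on \<open>A\<close>.
\<close>

section \<open>Polytopes and 0/1-valued slack functionals\<close>

lemma vert_subset: "vert P \<subseteq> P"
  by (auto simp: vert_def extreme_point_of_def)

lemma hull_vert: "polytope P \<Longrightarrow> convex hull (vert P) = P"
  unfolding vert_def
  using Krein_Milman_Minkowski[of P] polytope_imp_compact[of P] polytope_imp_convex[of P] by simp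

lemma finite_vert: "polytope P \<Longrightarrow> finite (vert P)"
  unfolding vert_def by (intro finite_polyhedron_extreme_points polytope_imp_polyhedron)

lemma vert_face: "K face_of P \<Longrightarrow> vert K = vert P \<inter> K"
  unfolding vert_def using extreme_point_of_face[of K P] by auto

lemma subset_if_vert_subset:
  assumes "polytope P" "convex C" "vert P \<subseteq> C" shows "P \<subseteq> C"
  using hull_minimal[of "vert P" C convex] hull_vert assms by auto

lemma facet_neq: "K facet_of P \<Longrightarrow> K \<noteq> P"
  by auto

definition unit_slack :: "'a::euclidean_space set \<Rightarrow> 'a set \<Rightarrow> 'a \<Rightarrow> real \<Rightarrow> bool" where
  "unit_slack P K a b \<longleftrightarrow>
     (\<forall>x\<in>P. 0 \<le> a \<bullet> x + b) \<and> K = P \<inter> {x. a \<bullet> x + b = 0} \<and> (\<forall>x\<in>vert P. a \<bullet> x + b \<in> {0, 1})"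

lemma unit_slack_at_vertex:
  "unit_slack P K a b \<Longrightarrow> x \<in> vert P \<Longrightarrow> a \<bullet> x + b = (if x \<in> K then 0 else 1)"
  using vert_subset[of P] unfolding unit_slack_def by auto

text \<open>
  A supporting functional is constant on the facet and, by 2-levelness, constant on the remaining
  vertices, so rescaling the difference of the two values to \<open>1\<close> gives the functional.
\<close>

lemma two_level_unit_slack:
  assumes "two_level P" "K facet_of P"
  shows "\<exists>a b. unit_slack P K a b"
proof -
  have poly: "polytope P" using assms by (simp add: two_level_def)
  obtain a b where ab: "a \<noteq> 0" "P \<subseteq> {x. a \<bullet> x \<le> b}" "K = P \<inter> {x. a \<bullet> x = b}"
    using facet_of_polyhedron[OF polytope_imp_polyhedron[OF poly] assms(2)] by metis
  then have "facet_defining {x. a \<bullet> x = b} P"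
    unfolding facet_defining_def using assms(2) by (intro exI[of _ a] exI[of _ b]) auto
  then obtain H' where H': "affine_parallel {x. a \<bullet> x = b} H'" "vert P - {x. a \<bullet> x = b} \<subseteq> H'"
    using assms(1) unfolding two_level_def by blast
  then obtain c where c: "H' = (\<lambda>x. c + x) ` {x. a \<bullet> x = b}"
    unfolding affine_parallel_def by blast
  have other: "a \<bullet> x = b + a \<bullet> c" if "x \<in> vert P" "x \<notin> K" for x
    using that H'(2) ab(3) vert_subset[of P] unfolding c by (auto simp: inner_right_distrib)
  have "\<not> vert P \<subseteq> K"
    using subset_if_vert_subset[OF poly, of K] face_of_imp_convex[of K P] facet_of_imp_subset[OF assms(2)]
      facet_of_imp_face_of[OF assms(2)] facet_neq[OF assms(2)] polytope_imp_convex[OF poly]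
    by blast
  then obtain x0 where x0: "x0 \<in> vert P" "x0 \<notin> K" by blast
  then have "a \<bullet> x0 < b" using ab vert_subset[of P] by force
  with other[OF x0] have neg: "a \<bullet> c < 0" by simp
  have eq: "((1 / (a \<bullet> c)) *\<^sub>R a) \<bullet> x + - b / (a \<bullet> c) = (b - a \<bullet> x) / (- (a \<bullet> c))" for x
    using neg by (simp add: divide_simps)
  have "unit_slack P K ((1 / (a \<bullet> c)) *\<^sub>R a) (- b / (a \<bullet> c))"
    unfolding unit_slack_def eq
  proof (intro conjI ballI)
    show "0 \<le> (b - a \<bullet> x) / - (a \<bullet> c)" if "x \<in> P" for x
      using that ab(2) neg by (intro divide_nonneg_pos) auto
    show "K = P \<inter> {x. (b - a \<bullet> x) / - (a \<bullet> c) = 0}"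
      using ab(3) neg by auto
    show "(b - a \<bullet> x) / - (a \<bullet> c) \<in> {0, 1}" if "x \<in> vert P" for x
      using other[OF that] ab(3) neg by (cases "x \<in> K") auto
  qed
  then show ?thesis by blast
qed

text \<open>
  This is how a facet of a facet gets extended to a facet of the whole polytope: a face of a face is
  a face of the polytope, hence an intersection of facets, one of which misses the given point.
\<close>

lemma facet_avoiding_point:
  assumes "polytope P" "K face_of P" "K \<noteq> {}" "x \<in> P" "x \<notin> K"
  shows "\<exists>L. L facet_of P \<and> K \<subseteq> L \<and> x \<notin> L"
  using face_of_polyhedron[OF polytope_imp_polyhedron[OF assms(1)] assms(2,3)] assms(4,5) by blast

lemma facet_maximal:
  assumes "polytope P" "K facet_of P" "L face_of P" "K \<subseteq> L" "L \<noteq> P"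
  shows "K = L"
proof (rule ccontr)
  assume "K \<noteq> L"
  have "K face_of L"
    using assms facet_of_imp_face_of face_of_subset face_of_imp_subset by metis
  then have "aff_dim K < aff_dim L"
    using face_of_aff_dim_lt \<open>K \<noteq> L\<close> face_of_imp_convex[OF assms(3)] polytope_imp_convex assms(1)
    by blast
  moreover have "aff_dim L < aff_dim P"
    using face_of_aff_dim_lt assms polytope_imp_convex by blast
  ultimately show False using assms(2) by (simp add: facet_of_def)
qed

text \<open>
  The facet inequalities describe a polytope within its affine hull.  A segment from a relatively
  interior point to a point outside would cross some facet strictly before its end, where the slack
  is still positive because it is positive at the start and nonnegative at the end.
\<close>

lemma mem_polytope_if_slacks_nonneg:
  assumes "polytope P" "P \<noteq> {}" "x \<in> affine hull P"
    and slack: "\<And>K. K facet_of P \<Longrightarrow> \<exists>a b. unit_slack P K a b \<and> 0 \<le> a \<bullet> x + b"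
  shows "x \<in> P"
proof (rule ccontr)
  assume "x \<notin> P"
  obtain z where z: "z \<in> rel_interior P"
    using rel_interior_eq_empty[OF polytope_imp_convex[OF assms(1)]] assms(2) by blast
  then have "z \<in> P" using rel_interior_subset by blast
  with \<open>x \<notin> P\<close> have "x - z \<noteq> 0" by auto
  then obtain d where d: "0 < d" "z + d *\<^sub>R (x - z) \<in> rel_frontier P"
      "\<And>e. \<lbrakk>0 \<le> e; e < d\<rbrakk> \<Longrightarrow> z + e *\<^sub>R (x - z) \<in> rel_interior P"
    using ray_to_rel_frontier[OF polytope_imp_bounded[OF assms(1)] z, of "x - z"] assms(3) by auto
  obtain K where K: "K facet_of P" "z + d *\<^sub>R (x - z) \<in> K"
    using d(2) rel_frontier_of_polyhedron[OF polytope_imp_polyhedron[OF assms(1)]] by auto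
  \<comment> \<open>The ray meets the relative frontier before it reaches \<open>x\<close>.\<close>
  have "\<not> 1 < d" using d(3)[of 1] rel_interior_subset \<open>x \<notin> P\<close> by auto
  moreover have "d \<noteq> 1" using K facet_of_imp_subset[OF K(1)] \<open>x \<notin> P\<close> by auto
  ultimately have "d < 1" by simp
  obtain a b where ab: "unit_slack P K a b" "0 \<le> a \<bullet> x + b" using slack[OF K(1)] by blast
  have "z \<notin> K"
    using face_of_disjoint_rel_interior[OF facet_of_imp_face_of[OF K(1)]] facet_neq[OF K(1)] z by blast
  then have "0 < a \<bullet> z + b" using ab(1) \<open>z \<in> P\<close> unfolding unit_slack_def by force
  then have "0 < (1 - d) * (a \<bullet> z + b) + d * (a \<bullet> x + b)"
    using ab(2) d(1) \<open>d < 1\<close> by (intro add_pos_nonneg) auto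
  also have "\<dots> = a \<bullet> (z + d *\<^sub>R (x - z)) + b" by (simp add: algebra_simps inner_simps)
  also have "\<dots> = 0" using ab(1) K(2) unfolding unit_slack_def by blast
  finally show False by simp
qed

text \<open>
  Vertices are the minimal nonempty faces and facets are maximal proper faces, so both are visible
  in the face lattice, and so is incidence.  A facet \<open>K\<close> of \<open>P\<close> corresponds to a proper face \<open>J\<close> of
  \<open>G\<close>; any facet \<open>L\<close> of \<open>Q\<close> that contains \<open>J\<close> but not \<open>G\<close> cuts \<open>G\<close> in a proper face containing \<open>J\<close>,
  which by maximality of \<open>K\<close> is \<open>J\<close> itself.
\<close>

lemma vertex_correspondence:
  assumes Q: "polytope (Q :: 'b::euclidean_space set)" and P: "polytope (P :: 'a::euclidean_space set)"
    and G: "G face_of Q" and comb: "comb_equivalent G P"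
  shows "\<exists>\<psi>. bij_betw \<psi> (vert P) (vert G) \<and>
     (\<forall>K. K facet_of P \<longrightarrow> (\<exists>L. L facet_of Q \<and> (\<forall>x\<in>vert P. \<psi> x \<in> L \<longleftrightarrow> x \<in> K)))"
proof -
  obtain \<phi> where bij: "bij_betw \<phi> {K. K face_of G} {L. L face_of P}"
    and mono: "\<And>K K'. K face_of G \<Longrightarrow> K' face_of G \<Longrightarrow> K \<subseteq> K' \<longleftrightarrow> \<phi> K \<subseteq> \<phi> K'"
    using comb unfolding comb_equivalent_def by blast
  have polyG: "polytope G" using face_of_polytope_polytope[OF Q G] .
  have face: "\<phi> K face_of P" if "K face_of G" for K
    using bij that by (auto simp: bij_betw_def)
  have surj: "\<exists>K. K face_of G \<and> \<phi> K = L" if "L face_of P" for L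
    using bij that unfolding bij_betw_def by (metis (mono_tags, lifting) imageE mem_Collect_eq)
  have inj: "K = K'" if "K face_of G" "K' face_of G" "\<phi> K = \<phi> K'" for K K'
    using mono[OF that(1,2)] mono[OF that(2,1)] that(3) by auto
  have empty: "\<phi> {} = {}"
  proof -
    obtain K where "K face_of G" "\<phi> K = {}" using surj[of "{}"] by auto
    then show ?thesis using mono[of "{}" K] by auto
  qed
  have top: "\<phi> G = P"
  proof -
    obtain K where K: "K face_of G" "\<phi> K = P"
      using surj[of P] face_of_refl polytope_imp_convex[OF P] by blast
    then have "\<phi> K \<subseteq> \<phi> G"
      using mono[of K G] face_of_refl polytope_imp_convex[OF polyG] face_of_imp_subset by metis
    then show ?thesis
      using K face[of G] face_of_refl polytope_imp_convex[OF polyG] face_of_imp_subset by blast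
  qed
  have has_vertex: "\<exists>x. x \<in> vert R" if "polytope R" "R \<noteq> {}" for R :: "'c::euclidean_space set"
    using extreme_point_exists_convex[of R] that polytope_imp_compact polytope_imp_convex
    unfolding vert_def by blast
  have single: "{x} face_of R" if "x \<in> vert R" for x and R :: "'c::euclidean_space set"
    using that by (simp add: vert_def face_of_singleton)
  have point_down: "\<exists>w\<in>vert G. \<phi> {w} = {x}" if x: "x \<in> vert P" for x
  proof -
    obtain K where K: "K face_of G" "\<phi> K = {x}" using surj[OF single[OF x]] by blast
    then have "K \<noteq> {}" using empty by auto
    then obtain w where w: "w \<in> vert K"
      using has_vertex face_of_polytope_polytope[OF polyG K(1)] by blast
    then have wG: "w \<in> vert G" "w \<in> K" using vert_face[OF K(1)] by auto
    have "\<phi> {w} \<subseteq> {x}" using mono[OF single[OF wG(1)] K(1)] K(2) wG(2) by auto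
    moreover have "\<phi> {w} \<noteq> {}" using inj[OF single[OF wG(1)], of "{}"] empty by auto
    ultimately show ?thesis using wG by blast
  qed
  have point_up: "\<exists>x\<in>vert P. \<phi> {w} = {x}" if w: "w \<in> vert G" for w
  proof -
    have "\<phi> {w} \<noteq> {}" using inj[OF single[OF w], of "{}"] empty by auto
    then obtain x where x: "x \<in> vert (\<phi> {w})"
      using has_vertex face_of_polytope_polytope[OF P face[OF single[OF w]]] by blast
    then have xP: "x \<in> vert P" "x \<in> \<phi> {w}" using vert_face[OF face[OF single[OF w]]] by auto
    obtain w' where w': "w' \<in> vert G" "\<phi> {w'} = {x}" using point_down[OF xP(1)] by blast
    then have "{w'} \<subseteq> {w}" using mono[OF single[OF w'(1)] single[OF w]] xP(2) by auto
    then show ?thesis using w' xP by auto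
  qed
  define \<psi> where "\<psi> x = (SOME w. w \<in> vert G \<and> \<phi> {w} = {x})" for x
  have \<psi>: "\<psi> x \<in> vert G" "\<phi> {\<psi> x} = {x}" if "x \<in> vert P" for x
    using someI_ex[of "\<lambda>w. w \<in> vert G \<and> \<phi> {w} = {x}"] point_down[OF that] unfolding \<psi>_def by blast+
  have "bij_betw \<psi> (vert P) (vert G)"
    unfolding bij_betw_def
  proof
    show "inj_on \<psi> (vert P)" by (rule inj_onI) (metis \<psi>(2) singleton_inject)
    show "\<psi> ` vert P = vert G"
    proof
      show "\<psi> ` vert P \<subseteq> vert G" using \<psi> by auto
      show "vert G \<subseteq> \<psi> ` vert P"
      proof
        fix w assume w: "w \<in> vert G"
        then obtain x where x: "x \<in> vert P" "\<phi> {w} = {x}" using point_up by blast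
        then have "w = \<psi> x" using inj[OF single[OF w] single[OF \<psi>(1)]] \<psi>(2) by auto
        with x show "w \<in> \<psi> ` vert P" by blast
      qed
    qed
  qed
  moreover have "\<exists>L. L facet_of Q \<and> (\<forall>x\<in>vert P. \<psi> x \<in> L \<longleftrightarrow> x \<in> K)" if K: "K facet_of P" for K
  proof -
    obtain J where J: "J face_of G" "\<phi> J = K" using surj facet_of_imp_face_of[OF K] by blast
    have "J \<noteq> {}" using J(2) empty K by (auto simp: facet_of_def)
    have "J \<noteq> G" using J(2) top facet_neq[OF K] by auto
    then obtain x where x: "x \<in> G" "x \<notin> J" using face_of_imp_subset[OF J(1)] by blast
    obtain L where L: "L facet_of Q" "J \<subseteq> L" "x \<notin> L"
      using facet_avoiding_point[OF Q face_of_trans[OF J(1) G] \<open>J \<noteq> {}\<close>, of x] x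
        face_of_imp_subset[OF G] by blast
    \<comment> \<open>The trace of \<open>L\<close> on \<open>G\<close> is a proper face that corresponds to a face above \<open>K\<close>.\<close>
    have LG: "L \<inter> G face_of G"
      using face_of_Int_subface[of L G Q] face_of_subset[of "L \<inter> G" Q G]
        face_of_Int[OF facet_of_imp_face_of[OF L(1)] G] face_of_imp_subset[OF G] by auto
    have "\<phi> (L \<inter> G) \<noteq> P"
      using inj[OF LG, of G] top face_of_refl[OF polytope_imp_convex[OF polyG]] L(3) x(1) by blast
    moreover have "K \<subseteq> \<phi> (L \<inter> G)"
      using mono[OF J(1) LG] J(2) L(2) face_of_imp_subset[OF J(1)] by auto
    ultimately have "K = \<phi> (L \<inter> G)" using facet_maximal[OF P K face[OF LG]] by blast
    then have eq: "L \<inter> G = J" using inj[OF LG J(1)] J(2) by simp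
    have "\<psi> y \<in> L \<longleftrightarrow> y \<in> K" if y: "y \<in> vert P" for y
      using eq mono[OF single[OF \<psi>(1)[OF y]] J(1)] \<psi>[OF y] J(2) vert_subset[of G] by auto
    then show ?thesis using L(1) by blast
  qed
  ultimately show ?thesis by blast
qed

section \<open>Lexicographic order and coordinates\<close>

lemma lex_le_total: "lex_le x y \<or> lex_le y x"
proof (cases "x = y")
  case False
  define p where "p = (LEAST p. x $ p \<noteq> y $ p)"
  have ex: "\<exists>p. x $ p \<noteq> y $ p" using False by (simp add: vec_eq_iff)
  have "x $ p \<noteq> y $ p" unfolding p_def by (rule LeastI_ex[OF ex])
  moreover have "\<forall>q<p. x $ q = y $ q" unfolding p_def using not_less_Least by blast
  ultimately show ?thesis unfolding lex_le_def by (metis linorder_neqE)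
qed (simp add: lex_le_def)

lemma lex_le_trans: 
  assumes "lex_le x y" "lex_le y z" shows "lex_le x z"
proof (cases "x = y \<or> y = z")
  case False
  then obtain p q where p: "x $ p < y $ p" "\<forall>r<p. x $ r = y $ r"
    and q: "y $ q < z $ q" "\<forall>r<q. y $ r = z $ r"
    using assms unfolding lex_le_def by blast
  show ?thesis
    unfolding lex_le_def
  proof (intro disjI2 exI[of _ "min p q"] conjI allI impI)
    show "x $ min p q < z $ min p q"
      using p q by (cases p q rule: linorder_cases) (auto simp: min_def)
  qed (use p q in auto)
qed (use assms in auto)

lemma lex_le_translate: "lex_le x y \<Longrightarrow> lex_le (x + z) (y + z)"
  unfolding lex_le_def by auto

lemma finite_lex_minimum:
  assumes "finite S" "S \<noteq> {}"
  shows "\<exists>m\<in>S. \<forall>x\<in>S. lex_le m x"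
  using assms
proof (induction rule: finite_ne_induct)
  case (insert x S)
  then obtain m where m: "m \<in> S" "\<forall>y\<in>S. lex_le m y" by blast
  show ?case
  proof (cases "lex_le m x")
    case False
    then have "lex_le x m" using lex_le_total by blast
    moreover have "lex_le x x" by (simp add: lex_le_def)
    ultimately show ?thesis using m lex_le_trans by (metis insert_iff)
  qed (use m in auto)
qed (simp add: lex_le_def)

lemma idx_image: "idx ` {1..CARD('n)} = (UNIV :: 'n::{finite,wellorder} set)"
proof -
  have "p \<in> idx ` {1..CARD('n)}" for p :: 'n
    using bij_betw_pos[where 'n='n] idx_pos[of p]
    by (metis bij_betwE UNIV_I imageI)
  then show ?thesis by auto
qed

lemma idx_inj: "inj_on (idx :: nat \<Rightarrow> 'n::{finite,wellorder}) {1..CARD('n)}"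
  by (metis inj_onI pos_idx)

lemma pos_range: "pos (p :: 'n::{finite,wellorder}) \<in> {1..CARD('n)}"
  using bij_betw_pos[where 'n='n] by (auto simp: bij_betw_def)

lemma idx_eq_iff:
  "i \<in> {1..CARD('n)} \<Longrightarrow> j \<in> {1..CARD('n)} \<Longrightarrow> (idx i :: 'n::{finite,wellorder}) = idx j \<longleftrightarrow> i = j"
  using inj_on_eq_iff[OF idx_inj[where 'n='n]] by blast

lemma pos_eq_1_iff: "pos (p :: 'n::{finite,wellorder}) = Suc 0 \<longleftrightarrow> p = idx (Suc 0)"
  using idx_pos[of p] pos_idx[of 1, where 'n='n] by auto

lemma sum_idx: "(\<Sum>p\<in>UNIV. h (p :: 'n::{finite,wellorder})) = (\<Sum>i\<in>{1..CARD('n)}. h (idx i))"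
  using sum.reindex[OF idx_inj, of h] idx_image[where 'n='n] by simp

lemma inner_evec: "a \<bullet> evec i = a $ idx i"
  by (simp add: evec_def inner_axis)

lemma evec_nth:
  "i \<in> {1..CARD('n)} \<Longrightarrow> j \<in> {1..CARD('n)} \<Longrightarrow>
    (evec i :: real ^ 'n::{finite,wellorder}) $ idx j = (if i = j then 1 else 0)"
  by (auto simp: evec_def axis_def idx_eq_iff)

lemma coordsum_evec:
  assumes "i \<in> {1..CARD('n)}" "E \<subseteq> {1..CARD('n)}"
  shows "coordsum (evec i :: real ^ 'n::{finite,wellorder}) E = (if i \<in> E then 1 else 0)"
proof -
  have "coordsum (evec i :: (real, 'n) vec) E = (\<Sum>j\<in>E. if i = j then 1 else 0)"
    unfolding coordsum_def using assms by (intro sum.cong) (auto simp: evec_nth)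
  then show ?thesis using finite_subset[OF assms(2)] by simp
qed

lemma coordsum_0: "coordsum 0 E = 0"
  by (simp add: coordsum_def)

text \<open>
  The constant term is \<open>0\<close> or \<open>1\<close>.  Accordingly all coefficients lie in \<open>{0,1}\<close> or all lie in
  \<open>{-1,0}\<close>, and \<open>E\<close> is the support.  This is why the facets of an \<open>\<H>\<close>-embedded 2-level polytope are
  all given by slab inequalities.
\<close>

lemma unit_functional_coordsum:
  fixes a :: "real ^ 'n::{finite,wellorder}"
  assumes "b \<in> {0, 1}" "\<And>i. i \<in> {1..CARD('n)} \<Longrightarrow> a \<bullet> evec i + b \<in> {0, 1}"
  shows "\<exists>E\<subseteq>{1..CARD('n)}.
     (\<forall>x. a \<bullet> x + b = coordsum x E) \<or> (\<forall>x. a \<bullet> x + b = 1 - coordsum x E)"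
proof -
  define E where "E = {i \<in> {1..CARD('n)}. a $ idx i \<noteq> 0}"
  have expand: "a \<bullet> x = (\<Sum>i\<in>E. a $ idx i * x $ idx i)" for x
    unfolding inner_vec_def inner_real_def sum_idx E_def
    by (rule sum.mono_neutral_right) auto
  have "E \<subseteq> {1..CARD('n)}" by (auto simp: E_def)
  moreover have "(\<forall>x. a \<bullet> x + b = coordsum x E) \<or> (\<forall>x. a \<bullet> x + b = 1 - coordsum x E)"
  proof (cases "b = 0")
    case True
    have "a $ idx i = 1" if "i \<in> E" for i
      using assms(2)[of i] that True by (auto simp: inner_evec E_def)
    then show ?thesis unfolding expand coordsum_def using True by simp
  next
    case False
    then have "b = 1" using assms(1) by simp
    have "a $ idx i = - 1" if "i \<in> E" for i
      using assms(2)[of i] that \<open>b = 1\<close> by (auto simp: inner_evec E_def)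
    then show ?thesis unfolding expand coordsum_def using \<open>b = 1\<close> by (simp add: sum_negf)
  qed
  ultimately show ?thesis by blast
qed

section \<open>Integral points in linear images of the cube\<close>

lemma matrix_inv_cancel:
  assumes "invertible (M :: real ^ 'm ^ 'm)"
  shows "matrix_inv M *v (M *v x) = x" "M *v (matrix_inv M *v x) = x"
proof -
  from assms have "M ** matrix_inv M = mat 1 \<and> matrix_inv M ** M = mat 1"
    unfolding invertible_def matrix_inv_def by (rule someI_ex)
  then show "matrix_inv M *v (M *v x) = x" "M *v (matrix_inv M *v x) = x"
    by (simp_all add: matrix_vector_mul_assoc)
qed

lemma unit_vector_notin_open_segment:
  fixes x y z :: "real ^ 'n::finite"
  assumes "\<And>p. y $ p \<in> {0..1}" "\<And>p. z $ p \<in> {0..1}" "\<And>p. x $ p \<in> {0, 1}"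
  shows "x \<notin> open_segment y z"
proof
  assume "x \<in> open_segment y z"
  then obtain u where u: "0 < u" "u < 1" "x = (1 - u) *\<^sub>R y + u *\<^sub>R z" "y \<noteq> z"
    by (auto simp: in_segment)
  have "y $ p = z $ p" for p
  proof -
    have e: "x $ p = (1 - u) * y $ p + u * z $ p" using u(3) by simp
    consider "x $ p = 0" | "x $ p = 1" using assms(3)[of p] by auto
    then show ?thesis
    proof cases
      case 1
      have "0 \<le> (1 - u) * y $ p" "0 \<le> u * z $ p" using assms(1,2)[of p] u by auto
      then have "(1 - u) * y $ p = 0" "u * z $ p = 0" using e 1 by linarith+
      then show ?thesis using u by simp
    next
      case 2
      have "0 \<le> (1 - u) * (1 - y $ p)" "0 \<le> u * (1 - z $ p)" using assms(1,2)[of p] u by auto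
      then have "(1 - u) * (1 - y $ p) = 0" "u * (1 - z $ p) = 0"
        using e 2 by (simp_all add: algebra_simps)
      then show ?thesis using u by simp
    qed
  qed
  then show False using u(4) by (simp add: vec_eq_iff)
qed

text \<open>
  The image of the hull under \<open>N\<close> lies in the unit cube, where the only integral points are the
  vertices.  A vertex of the cube is extreme in the smaller hull as well, so it is the image of one of
  the generating points.
\<close>

lemma mem_if_unit_image_integral:
  fixes N :: "real ^ 'm ^ 'm"
  assumes inv: "invertible N" and B: "\<And>x p. x \<in> B \<Longrightarrow> (N *v x) $ p \<in> {0, 1}"
    and x: "x \<in> convex hull B" "\<And>p. (N *v x) $ p \<in> \<int>"
  shows "x \<in> B"
proof -
  have lin: "linear (\<lambda>x. N *v x)" by simp
  define box where "box = {y :: real ^ 'm. \<forall>p. y $ p \<in> {0..1}}"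
  have "convex box"
  proof -
    have "box = (\<Inter>p. {y. y $ p \<ge> 0} \<inter> {y. y $ p \<le> 1})" by (auto simp: box_def)
    moreover have "convex {y :: real ^ 'm. y $ p \<ge> 0}" "convex {y :: real ^ 'm. y $ p \<le> 1}" for p
      using convex_halfspace_ge[of 0 "axis p 1 :: real ^ 'm"] convex_halfspace_le[of "axis p 1 :: real ^ 'm" 1]
      by (simp_all add: inner_axis')
    ultimately show ?thesis by (auto intro!: convex_INT convex_Int)
  qed
  have img: "(\<lambda>x. N *v x) ` (convex hull B) = convex hull ((\<lambda>x. N *v x) ` B)"
    by (rule convex_hull_linear_image[OF lin])
  have sub: "convex hull ((\<lambda>x. N *v x) ` B) \<subseteq> box"
  proof (intro hull_minimal \<open>convex box\<close> image_subsetI)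
    fix x assume "x \<in> B"
    then have "(N *v x) $ p = 0 \<or> (N *v x) $ p = 1" for p using B by blast
    then show "N *v x \<in> box" unfolding box_def by (auto, metis zero_le_one order_refl, metis zero_le_one order_refl)
  qed
  have mem: "N *v x \<in> convex hull ((\<lambda>x. N *v x) ` B)" using x(1) img by blast
  have "(N *v x) $ p \<in> {0, 1}" for p
  proof -
    obtain k :: int where k: "(N *v x) $ p = of_int k" using x(2)[of p] by (auto elim: Ints_cases)
    moreover have "0 \<le> (N *v x) $ p" "(N *v x) $ p \<le> 1" using mem sub by (auto simp: box_def)
    ultimately have "k = 0 \<or> k = 1" by auto
    then show ?thesis using k by auto
  qed
  then have "N *v x extreme_point_of (convex hull ((\<lambda>x. N *v x) ` B))"
    using mem sub unit_vector_notin_open_segment unfolding extreme_point_of_def box_def by blast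
  then have "N *v x \<in> (\<lambda>x. N *v x) ` B" by (rule extreme_point_of_convex_hull)
  then show ?thesis using matrix_inv_cancel(1)[OF inv] by (metis imageE)
qed

section \<open>The embedded base polytope and its core matrix\<close>

locale embedded_base =
  fixes P0 :: "(real ^ 'n::{finite,wellorder}) set"
    and F :: "nat \<Rightarrow> (real ^ 'n::{finite,wellorder}) set"
    and v :: "nat \<Rightarrow> real ^ 'n::{finite,wellorder}"
  assumes dim: "CARD('n) \<ge> 2"
    and two_level: "two_level P0"
    and aff_dim: "aff_dim P0 = int CARD('n) - 1"
    and core: "simplicial_core 2 (CARD('n) + 1) P0 F v"
    and v_evec: "\<forall>j\<in>{2..CARD('n)}. v j = evec j"
    and v_0: "v (CARD('n) + 1) = 0"
begin

lemma polytope: "polytope P0"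
  using two_level by (simp add: two_level_def)

lemma facet: "i \<in> {2..CARD('n) + 1} \<Longrightarrow> F i facet_of P0"
  using core by (simp add: simplicial_core_def)

lemma core_notin: "i \<in> {2..CARD('n) + 1} \<Longrightarrow> v i \<notin> F i"
  using core by (simp add: simplicial_core_def)

lemma core_in: "i \<in> {2..CARD('n) + 1} \<Longrightarrow> j \<in> {i<..CARD('n) + 1} \<Longrightarrow> v j \<in> F i"
  using core unfolding simplicial_core_def by blast

lemma vertex: "i \<in> {2..CARD('n) + 1} \<Longrightarrow> v i \<in> vert P0"
  using core by (simp add: simplicial_core_def)

lemma zero_vert: "0 \<in> vert P0"
  using vertex[of "CARD('n) + 1"] v_0 dim by simp

lemma evec_vert: "i \<in> {2..CARD('n)} \<Longrightarrow> evec i \<in> vert P0"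
  using vertex[of i] v_evec by simp

lemma idx_exhaust:
  assumes "\<And>i. i \<in> {2..CARD('n)} \<Longrightarrow> Q (idx i)" "Q (idx 1)"
  shows "Q (p :: 'n)"
proof -
  have "p = idx (pos p)" by (simp add: idx_pos)
  then show ?thesis using pos_range[of p] assms
    by (metis Suc_1 atLeastAtMost_iff not_less_eq_eq le_antisym)
qed

text \<open>
  The affine hull of \<open>P\<^sub>0\<close> contains \<open>0, e\<^sub>2, \<dots>, e\<^sub>d\<close>, so by its dimension it is the hyperplane
  spanned by them.
\<close>

lemma first_coord_0:
  assumes "x \<in> P0" shows "x $ idx 1 = 0"
proof -
  let ?H = "{x :: (real, 'n) vec. axis (idx 1) 1 \<bullet> x = 0}"
  define L where "L = span (evec ` {2..CARD('n)} :: ((real, 'n) vec) set)"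
  have "inj_on (evec :: nat \<Rightarrow> (real, 'n) vec) {2..CARD('n)}"
    by (rule inj_onI) (auto simp: evec_def axis_eq_axis idx_eq_iff)
  then have card: "card (evec ` {2..CARD('n)} :: ((real, 'n) vec) set) = CARD('n) - 1"
    by (simp add: card_image)
  have "independent (evec ` {2..CARD('n)} :: ((real, 'n) vec) set)"
    by (rule independent_mono[OF independent_Basis]) (auto simp: evec_def Basis_vec_def)
  then have dimL: "dim L = CARD('n) - 1"
    using card by (simp add: L_def dim_span dim_eq_card_independent)
  have sub: "evec ` {2..CARD('n)} \<subseteq> affine hull P0" and "0 \<in> affine hull P0"
    using evec_vert zero_vert vert_subset[of P0] hull_subset[of P0 affine] by blast+
  then have "affine hull P0 = span P0" using affine_hull_span_0 by blast
  then have "L \<subseteq> affine hull P0"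
    unfolding L_def using span_minimal[OF sub] by simp
  moreover have "subspace L" by (simp add: L_def)
  moreover have "aff_dim L = aff_dim P0"
    using dimL aff_dim dim aff_dim_subspace[OF \<open>subspace L\<close>] by simp
  ultimately have "affine hull P0 = L"
    using affine_dim_equal[of L "affine hull P0"] subspace_imp_affine subspace_0[of L] by auto
  then have "x \<in> L" using assms hull_subset[of P0 affine] by auto
  moreover have "L \<subseteq> ?H"
    unfolding L_def
    by (intro span_minimal subspace_hyperplane) (auto simp: inner_axis' evec_nth)
  ultimately show ?thesis by (auto simp: inner_axis')
qed

lemma core_matrix_first: "(core_matrix F v c *v x) $ idx 1 = x $ idx 1"
proof -
  have "(core_matrix F v c *v x) $ idx 1 = (\<Sum>q\<in>UNIV. if q = idx 1 then x $ q else 0)"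
    unfolding matrix_vector_mult_def vec_lambda_beta
    by (intro sum.cong refl) (auto simp: core_matrix_def pos_idx Let_def pos_eq_1_iff)
  then show ?thesis by simp
qed

text \<open>
  The functional vanishes at \<open>v\<^sub>d\<^sub>+\<^sub>1 = 0\<close>, hence is linear, and its coefficients are its values at the
  unit vectors.  For \<open>e\<^sub>2, \<dots>, e\<^sub>d\<close>, which are vertices of \<open>P\<^sub>0\<close>, these are the incidences recorded
  in the matrix; the value at \<open>e\<^sub>1\<close> is what the first column \<open>c\<close> is free to record.
\<close>

lemma core_matrix_row:
  assumes i: "i \<in> {2..CARD('n)}"
    and a: "\<And>x. x \<in> vert P0 \<Longrightarrow> a \<bullet> x + b = (if x \<in> F i then 0 else 1)"
    and c: "c i = a $ idx 1"
  shows "b = 0" "(core_matrix F v c *v x) $ idx i = a \<bullet> x"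
proof -
  have "0 \<in> F i" using core_in[of i "CARD('n) + 1"] i v_0 by auto
  then show b: "b = 0" using a[OF zero_vert] by simp
  have "core_matrix F v c $ idx i $ q = a $ q" for q
  proof (rule idx_exhaust[where p = q])
    show "core_matrix F v c $ idx i $ idx 1 = a $ idx 1"
      using i c by (simp add: core_matrix_def pos_idx)
  next
    fix j assume j: "j \<in> {2..CARD('n)}"
    then show "core_matrix F v c $ idx i $ idx j = a $ idx j"
      using i a[OF evec_vert[OF j]] b v_evec by (auto simp: core_matrix_def pos_idx inner_evec)
  qed
  then show "(core_matrix F v c *v x) $ idx i = a \<bullet> x"
    by (simp add: matrix_vector_mult_def inner_vec_def)
qed

lemma core_matrix_first_column:
  "core_matrix F v c *v x = core_matrix F v (\<lambda>_. 0) *v x + x $ idx 1 *\<^sub>R (\<chi> p. if p = idx 1 then 0 else c (pos p))"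
proof -
  have "(core_matrix F v c *v x) $ p = (core_matrix F v (\<lambda>_. 0) *v x) $ p
      + (\<Sum>q\<in>(UNIV :: 'n set). if q = idx 1 then x $ idx 1 * (if p = idx 1 then 0 else c (pos p)) else 0)" for p
    unfolding matrix_vector_mult_def vec_lambda_beta
    by (subst sum.distrib[symmetric], intro sum.cong refl) (auto simp: core_matrix_def Let_def pos_eq_1_iff)
  then show ?thesis by (simp add: vec_eq_iff)
qed

text \<open>
  Changing \<open>c\<close> does not affect points with first coordinate \<open>0\<close>, so \<open>c\<close> may be chosen to fit
  the slack functional of the facet.
\<close>

lemma core_matrix_vert:
  assumes "x \<in> vert P0" "i \<in> {2..CARD('n)}"
  shows "(core_matrix F v c *v x) $ idx i = (if x \<in> F i then 0 else 1)"
proof -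
  obtain a b where ab: "unit_slack P0 (F i) a b"
    using two_level_unit_slack[OF two_level facet[of i]] assms(2) by auto
  have x1: "x $ idx 1 = 0" using first_coord_0 assms(1) vert_subset[of P0] by blast
  have "(core_matrix F v c *v x) = (core_matrix F v (\<lambda>_. a $ idx 1) *v x)"
    using core_matrix_first_column[of c x] core_matrix_first_column[of "\<lambda>_. a $ idx 1" x] x1 by simp
  then show ?thesis
    using core_matrix_row(2)[where i = i and a = a and b = b and c = "\<lambda>_. a $ idx 1" and x = x]
      core_matrix_row(1)[where i = i and a = a and b = b and c = "\<lambda>_. a $ idx 1"] assms unit_slack_at_vertex[OF ab] by auto
qed

lemma core_matrix_evec_1:
  "core_matrix F v c *v evec 1 = (\<chi> p. if p = idx 1 then 1 else c (pos p))"
proof -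
  show ?thesis
    by (auto simp: vec_eq_iff evec_def matrix_vector_mult_basis column_def core_matrix_def Let_def pos_eq_1_iff
        pos_idx[of 1, where 'n='n, simplified])
qed

lemma mem_X_full:
  "x \<in> X_full F v \<longleftrightarrow> x $ idx 1 = 1 \<and>
     (\<exists>c. (\<forall>i\<in>{2..CARD('n)}. c i \<in> {0, 1} \<and> (core_matrix F v c *v x) $ idx i \<in> {0, 1}))"
    (is "_ \<longleftrightarrow> ?R")
proof
  assume "x \<in> X_full F v"
  then obtain c y where "\<forall>i\<in>{2..CARD('n)}. c i \<in> {0, 1}" "x = matrix_inv (core_matrix F v c) *v y"
    "y $ idx 1 = 1" "\<forall>i\<in>{2..CARD('n)}. y $ idx i \<in> {0, 1}"
    unfolding X_full_def by blast
  moreover from this have "core_matrix F v c *v x = y"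
    using matrix_inv_cancel(2)[OF core_matrix_invertible[OF core]] by simp
  ultimately show ?R using core_matrix_first[of c x] by metis
next
  assume ?R
  then obtain c where c: "x $ idx 1 = 1"
    "\<forall>i\<in>{2..CARD('n)}. c i \<in> {0, 1} \<and> (core_matrix F v c *v x) $ idx i \<in> {0, 1}" by blast
  have "x = matrix_inv (core_matrix F v c) *v (core_matrix F v c *v x)"
    using matrix_inv_cancel(1)[OF core_matrix_invertible[OF core]] by simp
  then show "x \<in> X_full F v"
    unfolding X_full_def using c core_matrix_first[of c x] by auto
qed

lemma core_matrix_lower:
  assumes "p < q" shows "core_matrix F v c $ p $ q = 0"
proof -
  have "{..p} \<subset> {..q}" using assms by auto
  then have "pos p < pos q" unfolding pos_def by (intro psubset_card_mono) auto
  then show ?thesis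
    using pos_range[of p] pos_range[of q] core_in[of "pos p" "pos q"]
    by (auto simp: core_matrix_def Let_def)
qed

lemma core_matrix_diagonal: "core_matrix F v c $ p $ p = 1"
  using pos_range[of p] core_notin[of "pos p"] by (auto simp: core_matrix_def Let_def)

lemma core_matrix_entry_Ints:
  assumes "\<forall>i\<in>{2..CARD('n)}. c i \<in> {0, 1}"
  shows "core_matrix F v c $ p $ q \<in> \<int>"
proof -
  have "c (pos p) \<in> \<int>" if "pos p \<noteq> Suc 0"
  proof -
    have "pos p \<in> {2..CARD('n)}" using pos_range[of p] that by auto
    then show ?thesis using assms by fastforce
  qed
  then show ?thesis by (auto simp: core_matrix_def Let_def)
qed

text \<open>
  The matrix is integral and lower triangular with unit diagonal, so forward substitution recovers
  \<open>x\<close> from its image within the integers.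
\<close>

lemma core_matrix_Ints:
  assumes "\<forall>i\<in>{2..CARD('n)}. c i \<in> {0, 1}"
  shows "(\<forall>p. (core_matrix F v c *v x) $ p \<in> \<int>) \<longleftrightarrow> (\<forall>p. x $ p \<in> \<int>)"
proof
  assume y: "\<forall>p. (core_matrix F v c *v x) $ p \<in> \<int>"
  show "\<forall>p. x $ p \<in> \<int>"
  proof
    fix p show "x $ p \<in> \<int>"
    proof (induction p rule: less_induct)
      case (less p)
      let ?g = "\<lambda>q. core_matrix F v c $ p $ q * x $ q"
      have "(core_matrix F v c *v x) $ p = x $ p + (\<Sum>q\<in>UNIV - {p}. ?g q)"
        by (simp add: matrix_vector_mult_def sum.remove[of UNIV p] core_matrix_diagonal)
      moreover have "?g q \<in> \<int>" if "q \<noteq> p" for q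
        using less[of q] core_matrix_lower[of p q c] core_matrix_entry_Ints[OF assms] that
        by (cases q p rule: linorder_cases) auto
      then have "(\<Sum>q\<in>UNIV - {p}. ?g q) \<in> \<int>" by (intro Ints_sum) auto
      ultimately show "x $ p \<in> \<int>"
        using y Ints_diff[of "(core_matrix F v c *v x) $ p" "\<Sum>q\<in>UNIV - {p}. ?g q"]
        by (metis add_diff_cancel_right')
    qed
  qed
next
  assume "\<forall>p. x $ p \<in> \<int>"
  then show "\<forall>p. (core_matrix F v c *v x) $ p \<in> \<int>"
    unfolding matrix_vector_mult_def vec_lambda_beta
    using core_matrix_entry_Ints[OF assms] by (auto intro!: Ints_sum Ints_mult)
qed

lemma cl_dch_subset: "cl_dch P0 F v A \<subseteq> X_full F v"
  by (auto simp: cl_dch_def)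

lemma evec_1_cl_dch: "evec 1 \<in> cl_dch P0 F v A"
proof -
  have "evec 1 \<in> X_full F v"
    unfolding mem_X_full using dim core_matrix_evec_1[of "\<lambda>_. 0"]
    by (auto simp: evec_nth idx_eq_iff intro!: exI[of _ "\<lambda>_. 0"])
  moreover have "0 \<le> coordsum (evec 1 :: (real, 'n) vec) E \<and> coordsum (evec 1 :: (real, 'n) vec) E \<le> 1"
    if "E \<subseteq> {1..CARD('n)}" for E
    using that dim by (simp add: coordsum_evec)
  ultimately show ?thesis unfolding cl_dch_def slab_sets_def by blast
qed

end

section \<open>Extensions of the base polytope are closed\<close>

text \<open>
  The set \<open>A\<close> plays the part of the vertices at height \<open>1\<close> of an \<open>\<H>\<close>-embedded 2-level polytope with
  facet \<open>P\<^sub>0\<close>.  The assumptions \<open>lift\<close> and \<open>slabs\<close> say what its facets contribute: 0/1-valued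
  functionals extending those of the facets of \<open>P\<^sub>0\<close>, and a description by slab inequalities.  The
  assumption \<open>least\<close> records how \<open>e\<^sub>1\<close> was chosen among the vertices at height \<open>1\<close>.
\<close>

locale facet_extension = embedded_base P0 F v
  for P0 :: "(real ^ 'n::{finite,wellorder}) set"
    and F :: "nat \<Rightarrow> (real ^ 'n::{finite,wellorder}) set"
    and v :: "nat \<Rightarrow> real ^ 'n::{finite,wellorder}" +
  fixes A :: "(real ^ 'n::{finite,wellorder}) set"
  assumes first_coord_1: "x \<in> A \<Longrightarrow> x $ idx 1 = 1"
    and evec_1: "evec 1 \<in> A"
    and lift: "K facet_of P0 \<Longrightarrow>
      \<exists>a b. (\<forall>x\<in>vert P0. a \<bullet> x + b = (if x \<in> K then 0 else 1)) \<and> (\<forall>x\<in>A. a \<bullet> x + b \<in> {0, 1})"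
    and slabs: "(\<And>E. E \<in> slab_sets (vert P0 \<union> A) \<Longrightarrow> 0 \<le> coordsum x E \<and> coordsum x E \<le> 1) \<Longrightarrow>
      x \<in> convex hull (vert P0 \<union> A)"
    and least: "x \<in> A \<Longrightarrow> core_le F v (evec 1) x"
begin

text \<open>
  One column \<open>c\<close> serves all points at once: it lists the values at \<open>e\<^sub>1\<close> of the functionals that extend
  the core facets.
\<close>

lemma ex_core_matrix_01:
  "\<exists>c. (\<forall>i\<in>{2..CARD('n)}. c i \<in> {0, 1}) \<and>
     (\<forall>x\<in>vert P0 \<union> A. \<forall>p. (core_matrix F v c *v x) $ p \<in> {0, 1})"
proof -
  have "\<exists>a. \<exists>b. (\<forall>x\<in>vert P0. a \<bullet> x + b = (if x \<in> F i then 0 else 1)) \<and> (\<forall>x\<in>A. a \<bullet> x + b \<in> {0, 1})"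
    if "i \<in> {2..CARD('n)}" for i
    using lift[OF facet[of i]] that by auto
  then obtain a b where ab: "\<And>i x. i \<in> {2..CARD('n)} \<Longrightarrow> x \<in> vert P0 \<Longrightarrow> a i \<bullet> x + b i = (if x \<in> F i then 0 else 1)"
    "\<And>i x. i \<in> {2..CARD('n)} \<Longrightarrow> x \<in> A \<Longrightarrow> a i \<bullet> x + b i \<in> {0, 1}"
    by metis
  define c where "c i = a i $ idx 1" for i
  have row: "b i = 0" "(core_matrix F v c *v x) $ idx i = a i \<bullet> x" if "i \<in> {2..CARD('n)}" for i x
    using core_matrix_row[OF that ab(1)[OF that]] by (auto simp: c_def)
  have "c i \<in> {0, 1}" if "i \<in> {2..CARD('n)}" for i
    using ab(2)[OF that evec_1] row(1)[OF that] by (simp add: c_def inner_evec)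
  moreover have "(core_matrix F v c *v x) $ p \<in> {0, 1}" if x: "x \<in> vert P0 \<union> A" for x p
  proof (rule idx_exhaust[where p = p])
    show "(core_matrix F v c *v x) $ idx 1 \<in> {0, 1}"
      unfolding core_matrix_first using x first_coord_0[of x] first_coord_1[of x] vert_subset[of P0] by auto
    show "(core_matrix F v c *v x) $ idx i \<in> {0, 1}" if "i \<in> {2..CARD('n)}" for i
      using x ab[OF that, of x] row[OF that] by (auto split: if_splits)
  qed
  ultimately show ?thesis by blast
qed

lemma subset_X_full: "A \<subseteq> X_full F v"
proof
  fix x assume x: "x \<in> A"
  obtain c where "\<forall>i\<in>{2..CARD('n)}. c i \<in> {0, 1}"
     "\<forall>x\<in>vert P0 \<union> A. \<forall>p. (core_matrix F v c *v x) $ p \<in> {0, 1}"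
    using ex_core_matrix_01 by blast
  then show "x \<in> X_full F v"
    unfolding mem_X_full using x first_coord_1[OF x] by (intro conjI exI[of _ c]) auto
qed

text \<open>
  Let \<open>x(E) = e\<close> with \<open>e \<in> {0,1}\<close> be the facet.  Its extending functional has constant term \<open>e\<close> and
  the coefficients of \<open>\<plusminus>x(E)\<close> in the coordinates \<open>2, \<dots>, d\<close>, with sign \<open>1 - 2e\<close>.  At height \<open>1\<close> the
  sum \<open>x(E)\<close> is therefore, up to sign, the difference of its 0/1-values at \<open>x\<close> and at \<open>e\<^sub>1\<close>.
\<close>

lemma facet_sum:
  assumes x: "x \<in> A" and E: "E \<in> facet_sets P0"
  shows "coordsum x E \<in> {-1, 0, 1}"
proof -
  have E_sub: "E \<subseteq> {2..CARD('n)}" "E \<noteq> {}" using E by (auto simp: facet_sets_def)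
  obtain e where e: "e \<in> {0, 1}" and K: "(P0 \<inter> {x. coordsum x E = e}) facet_of P0"
    using E by (auto simp: facet_sets_def)
  obtain a b where a: "\<And>x. x \<in> vert P0 \<Longrightarrow> a \<bullet> x + b = (if x \<in> P0 \<inter> {x. coordsum x E = e} then 0 else 1)"
    "\<And>x. x \<in> A \<Longrightarrow> a \<bullet> x + b \<in> {0, 1}"
    using lift[OF K] by blast
  have at_vert: "a \<bullet> x + b = (if coordsum x E = e then 0 else 1)" if "x \<in> vert P0" for x
    using a(1)[OF that] that vert_subset[of P0] by auto
  have b: "b = e" using at_vert[OF zero_vert] e by (auto simp: coordsum_0)
  have coeff: "a $ idx j = (if j \<in> E then 1 - 2 * e else 0)" if "j \<in> {2..CARD('n)}" for j
  proof -
    have "coordsum (evec j :: (real, 'n) vec) E = (if j \<in> E then 1 else 0)"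
      using that E_sub by (intro coordsum_evec) auto
    then show ?thesis using at_vert[OF evec_vert[OF that]] e b by (auto simp: inner_evec split: if_splits)
  qed
  have "a \<bullet> x = (\<Sum>i\<in>{1..CARD('n)}. a $ idx i * x $ idx i)"
    unfolding inner_vec_def inner_real_def sum_idx ..
  also have "\<dots> = a $ idx 1 * x $ idx 1 + (\<Sum>i\<in>{2..CARD('n)}. a $ idx i * x $ idx i)"
    using dim by (simp add: sum.atLeast_Suc_atMost numeral_2_eq_2)
  also have "(\<Sum>i\<in>{2..CARD('n)}. a $ idx i * x $ idx i) = (\<Sum>i\<in>E. (1 - 2 * e) * x $ idx i)"
    using E_sub by (intro sum.mono_neutral_cong_right) (auto simp: coeff)
  also have "\<dots> = (1 - 2 * e) * coordsum x E"
    by (simp add: coordsum_def sum_distrib_left)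
  finally have "a \<bullet> x = a $ idx 1 + (1 - 2 * e) * coordsum x E"
    using first_coord_1[OF x] by simp
  moreover have "a \<bullet> x + b \<in> {0, 1}" using a(2)[OF x] .
  moreover have "a $ idx 1 + b \<in> {0, 1}" using a(2)[OF evec_1] by (simp add: inner_evec)
  ultimately show ?thesis using e b by auto
qed

lemma subset_X_red: "A \<subseteq> X_red P0 F v"
  using subset_X_full facet_sum least by (auto simp: X_red_def X_inc_def)

text \<open>
  A point of the full ground set is defined by some matrix \<open>M\<^sub>d(c')\<close>, in general not by the matrix
  \<open>M\<^sub>d(c)\<close> of the extension.  Integrality is what carries over from one to the other.
\<close>

lemma cl_dch_fixed: "cl_dch P0 F v A = A"
proof
  show "A \<subseteq> cl_dch P0 F v A"
    using subset_X_full unfolding cl_dch_def slab_sets_def by blast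
  show "cl_dch P0 F v A \<subseteq> A"
  proof
    fix x assume "x \<in> cl_dch P0 F v A"
    then have x: "x \<in> X_full F v" "x \<in> convex hull (vert P0 \<union> A)"
      using slabs[of x] by (auto simp: cl_dch_def)
    obtain c where c: "\<forall>i\<in>{2..CARD('n)}. c i \<in> {0, 1}" and
      B: "\<forall>x\<in>vert P0 \<union> A. \<forall>p. (core_matrix F v c *v x) $ p \<in> {0, 1}"
      using ex_core_matrix_01 by blast
    obtain c' where x1: "x $ idx 1 = 1" and
      c': "\<forall>i\<in>{2..CARD('n)}. c' i \<in> {0, 1} \<and> (core_matrix F v c' *v x) $ idx i \<in> {0, 1}"
      using x(1) unfolding mem_X_full by blast
    have "(core_matrix F v c' *v x) $ p \<in> \<int>" for p
    proof (rule idx_exhaust[where p = p])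
      show "(core_matrix F v c' *v x) $ idx 1 \<in> \<int>" unfolding core_matrix_first x1 by simp
      show "(core_matrix F v c' *v x) $ idx i \<in> \<int>" if "i \<in> {2..CARD('n)}" for i
        using c' that by fastforce
    qed
    then have "\<forall>p. (core_matrix F v c *v x) $ p \<in> \<int>"
      using core_matrix_Ints[OF c, of x] core_matrix_Ints[of c' x] c' by blast
    then have "x \<in> vert P0 \<union> A"
      using mem_if_unit_image_integral[OF core_matrix_invertible[OF core, of c] _ x(2)] B by blast
    then show "x \<in> A" using x1 first_coord_0[of x] vert_subset[of P0] by auto
  qed
qed

lemma compatible:
  assumes xyz: "x \<in> vert P0 \<union> A" "y \<in> vert P0 \<union> A" "z \<in> vert P0 \<union> A"
  shows "\<not> incompatible P0 F v x y z"
proof -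
  have "\<exists>H1 H2. (\<exists>a b. a \<noteq> 0 \<and> H1 = {t. a \<bullet> t = b}) \<and> affine_parallel H1 H2 \<and>
      {H1, H2} \<noteq> {{t. t $ idx 1 = 0}, {t. t $ idx 1 = 1}} \<and> affine hull K \<subseteq> H1 \<union> H2 \<and>
      (\<forall>T. affine_parallel (affine hull K) T \<and> T \<inter> {x, y, z} \<noteq> {} \<longrightarrow> T \<subseteq> H1 \<union> H2)"
    if K: "K facet_of P0" for K
  proof -
    obtain a b where a: "\<And>x. x \<in> vert P0 \<Longrightarrow> a \<bullet> x + b = (if x \<in> K then 0 else 1)"
      "\<And>x. x \<in> A \<Longrightarrow> a \<bullet> x + b \<in> {0, 1}"
      using lift[OF K] by blast
    \<comment> \<open>The level sets of the functional extending \<open>K\<close> are the two covering hyperplanes.\<close>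
    define H1 where "H1 = {t. a \<bullet> t = - b}"
    define H2 where "H2 = {t. a \<bullet> t = 1 - b}"
    note Kface = facet_of_imp_face_of[OF K]
    have polyK: "polytope K" using face_of_polytope_polytope[OF polytope Kface] .
    have "vert K \<subseteq> H1"
      using a(1) by (force simp: H1_def vert_face[OF Kface])
    then have "K \<subseteq> H1"
      using subset_if_vert_subset[OF polyK, of H1] by (simp add: H1_def convex_hyperplane)
    then have hullK: "affine hull K \<subseteq> H1"
      by (intro hull_minimal) (auto simp: H1_def affine_hyperplane)
    obtain k where k: "k \<in> vert P0" "k \<in> K"
      using extreme_point_exists_convex[OF polytope_imp_compact[OF polyK] polytope_imp_convex[OF polyK]]
        K vert_face[OF Kface] by (auto simp: facet_of_def vert_def)
    have "\<not> vert P0 \<subseteq> K"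
      using subset_if_vert_subset[OF polytope face_of_imp_convex[OF Kface]] face_of_imp_subset[OF Kface]
        facet_neq[OF K] polytope_imp_convex[OF polytope] by blast
    then obtain l where l: "l \<in> vert P0" "l \<notin> K" by blast
    have kl: "a \<bullet> k = - b" "a \<bullet> l = 1 - b" using a(1)[OF k(1)] a(1)[OF l(1)] k l by auto
    have "a \<noteq> 0" using kl by auto
    have "affine_parallel H1 H2"
      unfolding affine_parallel_expl H1_def H2_def using \<open>a \<noteq> 0\<close>
      by (intro exI[of _ "(1 / (a \<bullet> a)) *\<^sub>R a"]) (auto simp: inner_right_distrib)
    moreover have "{H1, H2} \<noteq> {{t. t $ idx 1 = 0}, {t. t $ idx 1 = 1}}"
    proof
      assume "{H1, H2} = {{t. t $ idx 1 = 0}, {t. t $ idx 1 = 1}}"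
      then consider "H1 = {t. t $ idx 1 = 0}" | "H1 = {t. t $ idx 1 = 1}" by blast
      then show False
      proof cases
        case 1
        then have "l \<in> H1" using first_coord_0[of l] l vert_subset[of P0] by auto
        then show False using kl by (simp add: H1_def)
      next
        case 2
        have "k \<in> H1" using kl by (simp add: H1_def)
        then show False using 2 first_coord_0[of k] k vert_subset[of P0] by auto
      qed
    qed
    moreover have "T \<subseteq> H1 \<union> H2" if T: "affine_parallel (affine hull K) T" "T \<inter> {x, y, z} \<noteq> {}" for T
    proof
      fix t assume "t \<in> T"
      obtain u where u: "T = (\<lambda>s. u + s) ` (affine hull K)" using T(1) by (auto simp: affine_parallel_def)
      obtain w where w: "w \<in> T" "w \<in> vert P0 \<union> A" using T(2) xyz by blast
      have "a \<bullet> s = a \<bullet> u - b" if "s \<in> T" for s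
        using that hullK unfolding u H1_def by (auto simp: inner_right_distrib)
      then have "a \<bullet> t + b = a \<bullet> w + b" using w \<open>t \<in> T\<close> by simp
      moreover have "a \<bullet> w + b \<in> {0, 1}" using a(1)[of w] a(2)[of w] w(2) by (auto split: if_splits)
      ultimately show "t \<in> H1 \<union> H2" by (auto simp: H1_def H2_def)
    qed
    moreover have "\<exists>a b. a \<noteq> 0 \<and> H1 = {t. a \<bullet> t = b}" using \<open>a \<noteq> 0\<close> H1_def by blast
    ultimately show ?thesis using hullK by (intro exI[of _ H1] exI[of _ H2]) blast
  qed
  then show ?thesis unfolding incompatible_def by blast
qed

lemma closure_fixed: "(cl_inc P0 F v \<circ> cl_dch P0 F v) A = A"
  using compatible by (auto simp: cl_dch_fixed cl_inc_def)

end

section \<open>Constructing the extension from a polytope\<close>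

text \<open>
  The inverse sends \<open>e\<^sub>i\<close> to \<open>w\<^sub>i\<close> and \<open>0\<close> to the last point.  Its image is an affine subspace of
  \<open>aff Q\<close> of full dimension, hence all of \<open>aff Q\<close>, so it is a two-sided inverse there.  It transports
  the slack functionals of \<open>Q\<close> to the embedding even when \<open>Q\<close> lives in a space of larger dimension.
\<close>

lemma affine_inverse_on_affine_hull:
  fixes f h :: "'b::euclidean_space \<Rightarrow> real ^ 'n::{finite,wellorder}"
  assumes h: "linear h" and f: "\<And>q. f q = h q + d"
    and w: "\<And>i. i \<in> {1..CARD('n) + 1} \<Longrightarrow> w i \<in> affine hull Q"
    and f_w: "\<And>i. i \<in> {1..CARD('n)} \<Longrightarrow> f (w i) = evec i" and f_w_last: "f (w (CARD('n) + 1)) = 0"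
    and dimQ: "aff_dim Q = int CARD('n)"
  shows "\<exists>k u. linear k \<and> (\<forall>y. k y + u \<in> affine hull Q) \<and> (\<forall>y. f (k y + u) = y) \<and>
    (\<forall>q\<in>affine hull Q. k (f q) + u = q)"
proof -
  define u where "u = w (CARD('n) + 1)"
  define k where "k y = (\<Sum>i\<in>{1..CARD('n)}. y $ idx i *\<^sub>R (w i - u))" for y :: "real ^ 'n::{finite,wellorder}"
  have lin: "linear k"
    unfolding k_def
    by (intro linearI) (simp_all add: scaleR_add_left sum.distrib scaleR_right.sum)
  have u: "u \<in> affine hull Q" using w[of "CARD('n) + 1"] by (simp add: u_def)
  have in_hull: "k y + u \<in> affine hull Q" for y
  proof -
    have "(\<Sum>i\<in>I. y $ idx i *\<^sub>R (w i - u)) + u \<in> affine hull Q" if "finite I" "I \<subseteq> {1..CARD('n)}" for I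
      using that
    proof (induction I)
      case (insert i I)
      then show ?case
        using mem_affine_3_minus[OF affine_affine_hull, of "(\<Sum>i\<in>I. y $ idx i *\<^sub>R (w i - u)) + u" Q "w i" u "y $ idx i"]
          w[of i] u by (simp add: algebra_simps)
    qed (use u in simp)
    then show ?thesis unfolding k_def by blast
  qed
  have fk: "f (k y + u) = y" for y
  proof -
    have hu: "h u + d = 0" using f_w_last f by (simp add: u_def)
    have hw: "h (w i - u) = evec i" if "i \<in> {1..CARD('n)}" for i
    proof -
      have "h (w i) + d = evec i" using f_w[OF that] f by simp
      then have "(h (w i) + d) - (h u + d) = evec i" using hu by simp
      then show ?thesis by (simp add: linear_diff[OF h])
    qed
    have "h (k y) = (\<Sum>i\<in>{1..CARD('n)}. y $ idx i *\<^sub>R evec i)"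
      unfolding k_def by (simp add: linear_sum[OF h] linear_scale[OF h] hw)
    also have "\<dots> = (\<Sum>p\<in>UNIV. y $ p *\<^sub>R axis p 1)"
      unfolding sum_idx evec_def ..
    also have "\<dots> = y" using basis_expansion[of y] by (simp add: scalar_mult_eq_scaleR)
    finally show ?thesis using hu by (simp add: f linear_add[OF h] algebra_simps)
  qed
  have "inj k" by (rule injI) (metis fk)
  let ?S = "(\<lambda>y. u + y) ` range k"
  have "aff_dim ?S = aff_dim (affine hull Q)"
    using aff_dim_injective_linear_image[OF lin \<open>inj k\<close>, of UNIV] dimQ by (simp add: aff_dim_translation_eq)
  moreover have "affine ?S"
    using lin by (intro affine_translation[THEN iffD1] subspace_imp_affine linear_subspace_image) auto
  moreover have "?S \<subseteq> affine hull Q" using in_hull by (auto simp: add.commute)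
  ultimately have "?S = affine hull Q" by (intro affine_dim_equal) auto
  then have "\<exists>y. q = k y + u" if "q \<in> affine hull Q" for q
    using that by (metis (no_types, lifting) add.commute image_iff)
  then have "k (f q) + u = q" if "q \<in> affine hull Q" for q
    using that fk by metis
  then show ?thesis using lin in_hull fk by blast
qed

context embedded_base
begin

text \<open>
  By the lexicographically minimal choice of \<open>m\<close>, the point that becomes \<open>e\<^sub>1\<close>, the order condition
  holds: since \<open>M\<^sub>d(c)\<close> and \<open>M\<^sub>d(0)\<close> differ only in the first column, \<open>M\<^sub>d(0) f(q)\<close> is \<open>T q\<close> shifted
  by the same vector for all vertices \<open>q\<close> off \<open>G\<close>.
\<close>

lemma ex_facet_extension:
  fixes Q :: "'b::euclidean_space set"
  assumes Q: "two_level Q" "aff_dim Q = int CARD('n)"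
    and G: "G facet_of Q" "comb_equivalent G P0"
  shows "\<exists>A L w. facet_extension P0 F v A \<and> simplicial_core 1 (CARD('n) + 1) Q L w \<and>
    H_embedding Q w (convex hull (vert P0 \<union> A))"
proof -
  have polyQ: "polytope Q" using Q(1) by (simp add: two_level_def)
  note Gface = facet_of_imp_face_of[OF G(1)]
  obtain \<psi> where bij: "bij_betw \<psi> (vert P0) (vert G)"
    and facets: "\<And>K. K facet_of P0 \<Longrightarrow> \<exists>L. L facet_of Q \<and> (\<forall>x\<in>vert P0. \<psi> x \<in> L \<longleftrightarrow> x \<in> K)"
    using vertex_correspondence[OF polyQ polytope Gface G(2)] by blast
  have \<psi>: "\<psi> x \<in> vert Q" "\<psi> x \<in> G" if "x \<in> vert P0" for x
    using bij that vert_face[OF Gface] by (auto simp: bij_betw_def)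
  have "\<forall>i\<in>{2..CARD('n) + 1}. \<exists>L. L facet_of Q \<and> (\<forall>x\<in>vert P0. \<psi> x \<in> L \<longleftrightarrow> x \<in> F i)"
    using facets facet by blast
  then obtain L' where L': "\<And>i. i \<in> {2..CARD('n) + 1} \<Longrightarrow> L' i facet_of Q"
    "\<And>i x. i \<in> {2..CARD('n) + 1} \<Longrightarrow> x \<in> vert P0 \<Longrightarrow> \<psi> x \<in> L' i \<longleftrightarrow> x \<in> F i"
    by metis
  define L where "L i = (if i = 1 then G else L' i)" for i
  have L_facet: "L i facet_of Q" if "i \<in> {1..CARD('n) + 1}" for i
    using L'(1)[of i] G(1) that by (auto simp: L_def)
  have L_iff: "\<psi> x \<in> L i \<longleftrightarrow> x \<in> F i" if "i \<in> {2..CARD('n) + 1}" "x \<in> vert P0" for i x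
    using L'(2) that by (auto simp: L_def)
  have "\<forall>i\<in>{1..CARD('n) + 1}. \<exists>a b. unit_slack Q (L i) a b"
    using two_level_unit_slack[OF Q(1)] L_facet by blast
  then obtain a b where ab: "\<And>i. i \<in> {1..CARD('n) + 1} \<Longrightarrow> unit_slack Q (L i) (a i) (b i)"
    by metis
  define T where "T q = (\<chi> p :: 'n. a (pos p) \<bullet> q + b (pos p))" for q
  have T_vert: "T q $ idx i = (if q \<in> L i then 0 else 1)" if "q \<in> vert Q" "i \<in> {1..CARD('n)}" for q i
    using unit_slack_at_vertex[OF ab that(1), of i] that(2) by (simp add: T_def pos_idx)
  have T_1: "T q $ idx 1 = (if q \<in> G then 0 else 1)" if "q \<in> vert Q" for q
    using T_vert[OF that, of 1] dim by (simp add: L_def)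
  have "\<not> vert Q \<subseteq> G"
    using subset_if_vert_subset[OF polyQ face_of_imp_convex[OF Gface]] face_of_imp_subset[OF Gface]
      facet_neq[OF G(1)] polytope_imp_convex[OF polyQ] by blast
  then obtain m where m: "m \<in> vert Q" "m \<notin> G" and m_least: "\<And>q. q \<in> vert Q - G \<Longrightarrow> lex_le (T m) (T q)"
    using finite_lex_minimum[of "T ` (vert Q - G)"] finite_vert[OF polyQ] by blast
  define c where "c i = T m $ idx i" for i
  define C where "C = (\<chi> p :: 'n. if p = idx 1 then 0 else c (pos p))"
  let ?M = "core_matrix F v c"
  note M_inv = matrix_inv_cancel[OF core_matrix_invertible[OF core, of c]]
  define f where "f q = matrix_inv ?M *v T q" for q
  have Mf: "?M *v f q = T q" for q by (simp add: f_def M_inv)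
  have f_1: "f q $ idx 1 = (if q \<in> G then 0 else 1)" if "q \<in> vert Q" for q
    using T_1[OF that] core_matrix_first[of c "f q"] by (simp add: Mf)
  \<comment> \<open>The first column of \<open>M\<^sub>d(c)\<close> is \<open>T m\<close>.\<close>
  have fm: "f m = evec 1"
  proof -
    have "?M *v evec 1 = T m"
      unfolding core_matrix_evec_1 using T_1[OF m(1)] m(2) by (simp add: vec_eq_iff c_def idx_pos)
    then show ?thesis using M_inv(1)[of "evec 1"] by (simp add: f_def)
  qed
  \<comment> \<open>Both \<open>T (\<psi> x)\<close> and \<open>M\<^sub>d(c) x\<close> list the incidences of a vertex with the core facets.\<close>
  have f\<psi>: "f (\<psi> x) = x" if x: "x \<in> vert P0" for x
  proof -
    have "(?M *v x) $ p = T (\<psi> x) $ p" for p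
    proof (rule idx_exhaust[where p = p])
      show "(?M *v x) $ idx 1 = T (\<psi> x) $ idx 1"
        unfolding core_matrix_first using T_1[OF \<psi>(1)[OF x]] \<psi>(2)[OF x] first_coord_0 vert_subset[of P0] x
        by auto
      show "(?M *v x) $ idx i = T (\<psi> x) $ idx i" if i: "i \<in> {2..CARD('n)}" for i
        unfolding core_matrix_vert[OF x i] using T_vert[OF \<psi>(1)[OF x], of i] L_iff[of i x] x i by simp
    qed
    then have "?M *v x = T (\<psi> x)" by (simp add: vec_eq_iff)
    then show ?thesis using M_inv(1)[of x] by (simp add: f_def)
  qed
  define w where "w i = (if i = 1 then m else \<psi> (v i))" for i
  have w_vert: "w i \<in> vert Q" if "i \<in> {1..CARD('n) + 1}" for i
    using that m \<psi> vertex[of i] by (auto simp: w_def)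
  have core_Q: "simplicial_core 1 (CARD('n) + 1) Q L w"
    unfolding simplicial_core_def
  proof (intro conjI ballI)
    show "aff_dim Q = int (CARD('n) + 1) - int 1" using Q(2) by simp
    fix i assume i: "i \<in> {1..CARD('n) + 1}"
    show "L i facet_of Q" "w i \<in> vert Q" using L_facet[OF i] w_vert[OF i] .
    show "w i \<notin> L i"
      using i m(2) L_iff[of i "v i"] vertex[of i] core_notin[of i] by (auto simp: w_def L_def)
    show "w j \<in> L i" if j: "j \<in> {i<..CARD('n) + 1}" for j
    proof (cases "i = 1")
      case True
      then show ?thesis using j \<psi>(2) vertex[of j] by (auto simp: w_def L_def)
    next
      case False
      then show ?thesis using i j L_iff[of i "v j"] vertex[of j] core_in[of i j] by (auto simp: w_def)
    qed
  qed
  define A where "A = f ` (vert Q - G)"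
  have f_vert: "f ` vert Q = vert P0 \<union> A"
  proof -
    have "vert Q \<inter> G = \<psi> ` vert P0" using bij vert_face[OF Gface] by (simp add: bij_betw_def)
    then have "f ` (vert Q \<inter> G) = vert P0" using f\<psi> by (force simp: image_iff)
    moreover have "vert Q = (vert Q \<inter> G) \<union> (vert Q - G)" by blast
    ultimately show ?thesis unfolding A_def by (metis image_Un)
  qed
  define h where "h q = matrix_inv ?M *v (\<chi> p. a (pos p) \<bullet> q)" for q
  define d where "d = matrix_inv ?M *v (\<chi> p. b (pos p))"
  have f_eq: "f q = h q + d" for q
    unfolding f_def h_def d_def matrix_vector_right_distrib[symmetric]
    by (rule arg_cong[where f = "\<lambda>y. matrix_inv ?M *v y"]) (simp add: T_def vec_eq_iff)
  have "linear (\<lambda>q. (\<chi> p :: 'n. a (pos p) \<bullet> q))"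
    by (intro linearI) (simp_all add: vec_eq_iff inner_right_distrib)
  then have lin: "linear h"
    unfolding h_def
    using linear_compose[of "\<lambda>q. (\<chi> p :: 'n. a (pos p) \<bullet> q)" "\<lambda>y. matrix_inv ?M *v y"] by (simp add: o_def)
  have f_image: "f ` Q = convex hull (vert P0 \<union> A)"
  proof -
    have "f ` S = (\<lambda>y. d + y) ` (h ` S)" for S
      by (auto simp: f_eq image_image add.commute)
    then show ?thesis
      unfolding f_vert[symmetric] using hull_vert[OF polyQ] convex_hull_linear_image[OF lin, of "vert Q"]
        convex_hull_translation[of d "h ` vert Q"] by simp
  qed
  have f_w: "f (w i) = evec i" if "i \<in> {1..CARD('n)}" for i
    using that fm f\<psi>[OF vertex[of i]] v_evec by (auto simp: w_def)
  have f_w_last: "f (w (CARD('n) + 1)) = 0"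
    using f\<psi>[OF vertex[of "CARD('n) + 1"]] v_0 dim by (simp add: w_def)
  have emb: "H_embedding Q w (convex hull (vert P0 \<union> A))"
    unfolding H_embedding_def f_image[symmetric] using f_w f_w_last lin f_eq
    by (intro exI[of _ f] conjI exI[of _ h] exI[of _ d]) auto
  have w_hull: "w i \<in> affine hull Q" if "i \<in> {1..CARD('n) + 1}" for i
    using w_vert[OF that] vert_subset[of Q] hull_subset[of Q affine] by blast
  obtain k u where k: "linear k" "\<And>y. k y + u \<in> affine hull Q" "\<And>y. f (k y + u) = y"
    "\<And>q. q \<in> affine hull Q \<Longrightarrow> k (f q) + u = q"
    using affine_inverse_on_affine_hull[OF lin f_eq w_hull f_w f_w_last Q(2)] by blast
  \<comment> \<open>A functional on the space of \<open>Q\<close>, precomposed with the inverse of \<open>f\<close>.\<close>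
  have pullback: "adjoint k a' \<bullet> y + (a' \<bullet> u + b') = a' \<bullet> (k y + u) + b'" for a' b' y
    using adjoint_works[OF k(1), of y a'] by (simp add: inner_add_right inner_commute)
  have pullback_slack: "adjoint k a' \<bullet> f q + (a' \<bullet> u + b') = (if q \<in> J then 0 else 1)"
    if slack: "unit_slack Q J a' b'" and q: "q \<in> vert Q" for J a' b' q
  proof -
    have hull: "q \<in> affine hull Q" using q vert_subset[of Q] hull_subset[of Q affine] by blast
    show ?thesis unfolding pullback k(4)[OF hull] by (rule unit_slack_at_vertex[OF slack q])
  qed
  have "facet_extension P0 F v A"
  proof (intro facet_extension.intro embedded_base_axioms facet_extension_axioms.intro)
    show "x $ idx 1 = 1" if "x \<in> A" for x
      using that f_1 by (auto simp: A_def)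
    show "evec 1 \<in> A" using m fm by (force simp: A_def)
  next
    fix K assume "K facet_of P0"
    then obtain J where J: "J facet_of Q" "\<And>x. x \<in> vert P0 \<Longrightarrow> \<psi> x \<in> J \<longleftrightarrow> x \<in> K"
      using facets by blast
    obtain a' b' where slack: "unit_slack Q J a' b'" using two_level_unit_slack[OF Q(1) J(1)] by blast
    show "\<exists>a b. (\<forall>x\<in>vert P0. a \<bullet> x + b = (if x \<in> K then 0 else 1)) \<and> (\<forall>x\<in>A. a \<bullet> x + b \<in> {0, 1})"
    proof (intro exI conjI ballI)
      show "adjoint k a' \<bullet> x + (a' \<bullet> u + b') = (if x \<in> K then 0 else 1)" if "x \<in> vert P0" for x
        using pullback_slack[OF slack \<psi>(1)[OF that]] unfolding f\<psi>[OF that] J(2)[OF that] .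
      show "adjoint k a' \<bullet> x + (a' \<bullet> u + b') \<in> {0, 1}" if x: "x \<in> A" for x
      proof -
        obtain q where "q \<in> vert Q" "x = f q" using x by (auto simp: A_def)
        then show ?thesis using pullback_slack[OF slack, of q] by (cases "q \<in> J") simp_all
      qed
    qed
  next
    fix x :: "(real, 'n) vec"
    assume slab: "\<And>E. E \<in> slab_sets (vert P0 \<union> A) \<Longrightarrow> 0 \<le> coordsum x E \<and> coordsum x E \<le> 1"
    have "k x + u \<in> Q"
    proof (rule mem_polytope_if_slacks_nonneg[OF polyQ _ k(2)])
      show "Q \<noteq> {}" using m(1) vert_subset[of Q] by blast
    next
      fix J assume J: "J facet_of Q"
      obtain a' b' where slack: "unit_slack Q J a' b'" using two_level_unit_slack[OF Q(1) J] by blast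
      let ?a = "adjoint k a'" and ?b = "a' \<bullet> u + b'"
      have vals: "?a \<bullet> y + ?b \<in> {0, 1}" if "y \<in> vert P0 \<union> A" for y
      proof -
        have "y \<in> f ` vert Q" using that f_vert by simp
        then obtain q where "q \<in> vert Q" "y = f q" by blast
        then show ?thesis using pullback_slack[OF slack, of q] by (cases "q \<in> J") simp_all
      qed
      have "0 \<in> vert P0 \<union> A" using zero_vert by simp
      from vals[OF this] have "?b \<in> {0, 1}" by (simp only: inner_zero_right add_0_left)
      moreover have "?a \<bullet> evec i + ?b \<in> {0, 1}" if "i \<in> {1..CARD('n)}" for i
      proof -
        have "w i \<in> vert Q" using w_vert[of i] that by simp
        then have "evec i \<in> f ` vert Q" using f_w[OF that] by (metis imageI)
        then show ?thesis using vals f_vert by blast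
      qed
      ultimately obtain E where E: "E \<subseteq> {1..CARD('n)}"
        "(\<forall>y. ?a \<bullet> y + ?b = coordsum y E) \<or> (\<forall>y. ?a \<bullet> y + ?b = 1 - coordsum y E)"
        using unit_functional_coordsum[of ?b ?a] by blast
      have "0 \<le> coordsum y E \<and> coordsum y E \<le> 1" if "y \<in> vert P0 \<union> A" for y
        using E(2) vals[OF that] by auto
      then have "E \<in> slab_sets (vert P0 \<union> A)" if "E \<noteq> {}"
        using that E(1) by (simp add: slab_sets_def)
      then have "0 \<le> coordsum x E \<and> coordsum x E \<le> 1"
        using slab[of E] by (cases "E = {}") (auto simp: coordsum_def)
      then have "0 \<le> ?a \<bullet> x + ?b" using E(2) by auto
      then show "\<exists>a b. unit_slack Q J a b \<and> 0 \<le> a \<bullet> (k x + u) + b"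
        using slack unfolding pullback by blast
    qed
    then have "f (k x + u) \<in> f ` Q" by blast
    then show "x \<in> convex hull (vert P0 \<union> A)" unfolding f_image k(3) .
  next
    fix x assume "x \<in> A"
    then obtain q where q: "q \<in> vert Q - G" "x = f q" by (auto simp: A_def)
    have shift: "core_matrix F v (\<lambda>_. 0) *v f r = T r + - C" if "r \<in> vert Q - G" for r
      using core_matrix_first_column[of c "f r"] f_1[of r] that by (simp add: Mf C_def)
    show "core_le F v (evec 1) x"
      unfolding core_le_def fm[symmetric] q(2) using shift[OF q(1)] shift[of m] m
        lex_le_translate[OF m_least[OF q(1)], of "- C"] by simp
  qed
  with core_Q emb show ?thesis by (intro exI conjI)
qed

end

theorem lemma23:
  fixes P0 :: "(real ^ 'n::{finite,wellorder}) set"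
    and F :: "nat \<Rightarrow> (real ^ 'n::{finite,wellorder}) set"
    and v :: "nat \<Rightarrow> real ^ 'n::{finite,wellorder}"
  assumes "CARD('n) \<ge> 2"
    and "two_level P0"
    and "aff_dim P0 = int CARD('n) - 1"
    and "simplicial_core 2 (CARD('n) + 1) P0 F v"
    and "\<forall>j\<in>{2..CARD('n)}. v j = evec j"
    and "v (CARD('n) + 1) = 0"
  shows "complete_family TYPE('b::euclidean_space) P0
           {A. A \<subseteq> X_red P0 F v \<and> (cl_inc P0 F v \<circ> cl_dch P0 F v) A = A}"
proof -
  have base: "embedded_base P0 F v"
    using assms by (rule embedded_base.intro)
  have "evec 1 \<in> A" if A: "(cl_inc P0 F v \<circ> cl_dch P0 F v) A = A" for A
  proof -
    have "cl_dch P0 F v A \<subseteq> cl_inc P0 F v (cl_dch P0 F v A)"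
      using embedded_base.cl_dch_subset[OF base] by (simp add: cl_inc_def)
    then show ?thesis using embedded_base.evec_1_cl_dch[OF base, of A] A by (metis comp_apply subsetD)
  qed
  moreover have "\<exists>A\<in>{A. A \<subseteq> X_red P0 F v \<and> (cl_inc P0 F v \<circ> cl_dch P0 F v) A = A}.
      \<exists>L w. simplicial_core 1 (CARD('n) + 1) Q L w \<and> H_embedding Q w (convex hull (vert P0 \<union> A))"
    if Q: "two_level Q" "aff_dim Q = int CARD('n)" "G facet_of Q" "comb_equivalent G P0"
    for Q G :: "'b set"
  proof -
    obtain A L w where A: "facet_extension P0 F v A"
      and Lw: "simplicial_core 1 (CARD('n) + 1) Q L w" "H_embedding Q w (convex hull (vert P0 \<union> A))"
      using embedded_base.ex_facet_extension[OF base Q] by blast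
    show ?thesis
      using facet_extension.subset_X_red[OF A] facet_extension.closure_fixed[OF A] Lw
      by (intro bexI[of _ A] exI[of _ L] exI[of _ w]) simp_all
  qed
  ultimately show ?thesis
    unfolding complete_family_def by (intro conjI ballI allI impI) (simp, metis (no_types, lifting))
qed

end
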